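(* Let $\{z_n\}_{n\ge1}$ be an interpolating sequence for $H^\infty$ in the open unit disc $\mathbb{D}$. Then $\{z_n\}$ is an $EIS_\infty$ sequence if and only if there exists a sequence $m_j\in(0,1)$ with $m_j\to1$ such that any sequence $\{a_j\}$ of complex numbers satisfying $|a_j|\le m_j$ for all $j$ can be interpolated by an $H^\infty$ function of norm $1$ (that is, there is $F\in H^\infty$ of norm $1$ with $F(z_j)=a_j$ for all $j$).
   Context: $H^\infty$ is the algebra of bounded analytic functions on $\mathbb{D}$ with the supremum norm $\|\cdot\|_\infty$. A sequence $\{z_n\}\subset\mathbb{D}$ is interpolating for $H^\infty$ if for every $w\in\ell^\infty$ there is $f\in H^\infty$ with $f(z_j)=w_j$ for all $j$. For a sequence $a=\{a_j\}$ and a positive integer $N$, $\|a\|_{N,\ell^\infty}:=\sup_{j\ge N}|a_j|$. The sequence $\{z_n\}$ is an eventual $1$-interpolating sequence for $H^\infty$ ($EIS_\infty$) if for every $\varepsilon>0$ there exists $N$ such that for each $a\in\ell^\infty$ there exists $f_N\in H^\infty$ (depending on $a$) with $f_N(z_n)=a_n$ for all $n\ge N$ and $\|f_N\|_\infty\le(1+\varepsilon)\|a\|_{N,\ell^\infty}$. *)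

theory Defs
  imports "HOL-Complex_Analysis.Complex_Analysis"
begin

text \<open>
  Sequences are functions on \<^typ>\<open>nat\<close> and start at index 0; a sequence indexed by
  the positive integers corresponds to this by a shift of the index by one.
\<close>

text \<open>
  Elements of \<open>Hinf\<close> are total functions on \<^typ>\<open>complex\<close>; only their values on the
  open unit disc matter.
\<close>

definition Hinf :: "(complex \<Rightarrow> complex) set" where
  "Hinf = {f. f holomorphic_on ball 0 1 \<and> bounded (f ` ball 0 1)}"

definition Hinf_norm :: "(complex \<Rightarrow> complex) \<Rightarrow> real" where
  "Hinf_norm f = (SUP w\<in>ball 0 1. norm (f w))"

definition linf :: "(nat \<Rightarrow> complex) set" where
  "linf = {a. bounded (range a)}"

definition linf_tail_norm :: "nat \<Rightarrow> (nat \<Rightarrow> complex) \<Rightarrow> real" where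
  "linf_tail_norm N a = (SUP j\<in>{N..}. norm (a j))"

definition interpolating_Hinf :: "(nat \<Rightarrow> complex) \<Rightarrow> bool" where
  "interpolating_Hinf z \<longleftrightarrow> (\<forall>w\<in>linf. \<exists>f\<in>Hinf. \<forall>j. f (z j) = w j)"

definition EIS_inf :: "(nat \<Rightarrow> complex) \<Rightarrow> bool" where
  "EIS_inf z \<longleftrightarrow>
    (\<forall>\<epsilon>>0. \<exists>N. \<forall>a\<in>linf. \<exists>f\<in>Hinf.
       (\<forall>n\<ge>N. f (z n) = a n) \<and> Hinf_norm f \<le> (1 + \<epsilon>) * linf_tail_norm N a)"

end

theory Submission
  imports Defs
begin

text \<open>
  Let \<open>G\<close> be the Gram matrix of the normalised Szegoe kernels at the points \<open>z j\<close>. By the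
  Nevanlinna--Pick theorem (proved for finitely many nodes with the Schur algorithm), a function
  of norm at most \<open>M\<close> with values \<open>a j\<close> at \<open>z j\<close> gives \<open>D G D* \<le> M^2 G\<close> for \<open>D = diag a\<close>, and
  conversely \<open>D G D* < G\<close> on all finite sections yields, by Montel's theorem, an interpolating
  function of norm at most 1.

  If \<open>z\<close> is eventually 1-interpolating, choosing \<open>a\<close> to be suitable signs shows that the tails of \<open>G\<close>
  are close to the identity. Since moreover the rows of \<open>G\<close> are square summable, \<open>G - I\<close> is
  compact, and as \<open>z\<close> is interpolating, \<open>G\<close> is bounded below. Cutting the index set into rapidly
  growing blocks yields \<open>diag \<sigma> \<le> G \<le> diag \<tau>\<close> with \<open>\<sigma>\<close> and \<open>\<tau>\<close> positive and tending to 1. If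
  \<open>|a j|^2 < \<sigma> j / \<tau> j\<close>, then \<open>D G D* < G\<close>, so \<open>m j\<close> slightly below \<open>sqrt (\<sigma> j / \<tau> j)\<close> works.
  The norm is raised to exactly 1 by adding a multiple of a nonzero bounded function
  that vanishes at all \<open>z j\<close>. The converse implication is a rescaling.
\<close>

section \<open>Nevanlinna--Pick interpolation at finitely many nodes\<close>

definition herm_form :: "('i \<Rightarrow> 'i \<Rightarrow> complex) \<Rightarrow> 'i set \<Rightarrow> ('i \<Rightarrow> complex) \<Rightarrow> complex" where
  "herm_form k A x = (\<Sum>i\<in>A. \<Sum>j\<in>A. x i * cnj (x j) * k i j)"

text \<open>With \<open>a\<close> identically 0 this is the Szego kernel on the nodes, from which
  \<open>szego_gram\<close> is built.\<close>

definition pick :: "('i \<Rightarrow> complex) \<Rightarrow> ('i \<Rightarrow> complex) \<Rightarrow> 'i \<Rightarrow> 'i \<Rightarrow> complex" where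
  "pick z a i j = (1 - a i * cnj (a j)) / (1 - z i * cnj (z j))"

lemma herm_form_cong:
  assumes "\<And>i j. i \<in> A \<Longrightarrow> j \<in> A \<Longrightarrow> x i * cnj (x j) * k i j = y i * cnj (y j) * l i j"
  shows "herm_form k A x = herm_form l A y"
  unfolding herm_form_def using assms by (intro sum.cong refl) auto

lemma one_minus_cnj_mult_nonzero:
  fixes u v :: complex
  assumes "norm u < 1" "norm v < 1"
  shows "1 - cnj u * v \<noteq> 0" "1 - u * cnj v \<noteq> 0"
proof -
  have "norm (cnj u * v) < 1" "norm (u * cnj v) < 1"
    using norm_mult_less[of "cnj u" 1 v 1] norm_mult_less[of u 1 "cnj v" 1] assms by auto
  then show "1 - cnj u * v \<noteq> 0" "1 - u * cnj v \<noteq> 0" by auto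
qed

lemma Moebius_one_minus_mult:
  assumes "norm w < 1" "norm u < 1" "norm v < 1"
  shows "1 - Moebius_function 0 w u * cnj (Moebius_function 0 w v) =
    (1 - w * cnj w) * (1 - u * cnj v) / ((1 - cnj w * u) * cnj (1 - cnj w * v))"
proof -
  have "1 - cnj w * u \<noteq> 0" "1 - w * cnj v \<noteq> 0"
    using one_minus_cnj_mult_nonzero assms by blast+
  moreover have "1 - p / c * (q / d) = (c * d - p * q) / (c * d)" if "c \<noteq> 0" "d \<noteq> 0" for p q c d :: complex
    using that by (simp add: field_simps)
  ultimately show ?thesis
    by (simp add: Moebius_function_simple) (simp add: algebra_simps)
qed

text \<open>A Moebius map multiplies \<open>1 - u * cnj v\<close> by a positive scalar and a
  rank-one factor. Hence the Pick matrix changes only by a diagonal congruence, which preserves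
  positivity.\<close>

lemma pick_Moebius:
  assumes \<zeta>: "norm \<zeta> < 1" and \<alpha>: "norm \<alpha> < 1"
    and z: "\<And>i. i \<in> A \<Longrightarrow> norm (z i) < 1" and a: "\<And>i. i \<in> A \<Longrightarrow> norm (a i) < 1"
  obtains d where "\<And>i. i \<in> A \<Longrightarrow> d i \<noteq> 0"
    and "\<And>i j. i \<in> A \<Longrightarrow> j \<in> A \<Longrightarrow>
      pick (\<lambda>i. Moebius_function 0 \<zeta> (z i)) (\<lambda>i. Moebius_function 0 \<alpha> (a i)) i j =
      d i * cnj (d j) * pick z a i j"
proof
  \<comment> \<open>The quotient of the two scalars is shared equally between \<open>d i\<close> and
    \<open>cnj (d j)\<close>, hence the real square root.\<close>
  define s where "s = sqrt ((1 - (norm \<alpha>)\<^sup>2) / (1 - (norm \<zeta>)\<^sup>2))"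
  define d where "d i = (1 - cnj \<zeta> * z i) / (1 - cnj \<alpha> * a i) * of_real s" for i
  have pos: "1 - (norm \<alpha>)\<^sup>2 > 0" "1 - (norm \<zeta>)\<^sup>2 > 0"
    using \<zeta> \<alpha> by (simp_all add: abs_square_less_1)
  then have s: "s > 0" "s\<^sup>2 = (1 - (norm \<alpha>)\<^sup>2) / (1 - (norm \<zeta>)\<^sup>2)"
    by (auto simp: s_def)
  have ss: "of_real s * of_real s = (1 - \<alpha> * cnj \<alpha>) / (1 - \<zeta> * cnj \<zeta>)"
  proof -
    have "of_real s * of_real s = complex_of_real (s\<^sup>2)"
      by (simp add: power2_eq_square)
    then show ?thesis
      by (simp add: s flip: complex_norm_square)
  qed
  show "d i \<noteq> 0" if "i \<in> A" for i
    using one_minus_cnj_mult_nonzero[OF \<zeta> z[OF that]] one_minus_cnj_mult_nonzero[OF \<alpha> a[OF that]] s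
    by (simp add: d_def)
  show "pick (\<lambda>i. Moebius_function 0 \<zeta> (z i)) (\<lambda>i. Moebius_function 0 \<alpha> (a i)) i j =
      d i * cnj (d j) * pick z a i j" if ij: "i \<in> A" "j \<in> A" for i j
  proof -
    have dd: "d i * cnj (d j) = (1 - cnj \<zeta> * z i) * cnj (1 - cnj \<zeta> * z j) /
        ((1 - cnj \<alpha> * a i) * cnj (1 - cnj \<alpha> * a j)) * ((1 - \<alpha> * cnj \<alpha>) / (1 - \<zeta> * cnj \<zeta>))"
      unfolding ss[symmetric] d_def by simp
    show ?thesis
      unfolding dd pick_def Moebius_one_minus_mult[OF \<zeta> z[OF ij(1)] z[OF ij(2)]]
        Moebius_one_minus_mult[OF \<alpha> a[OF ij(1)] a[OF ij(2)]]
      by (simp add: mult_ac)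
  qed
qed

text \<open>This rests on \<open>(1 - t * c) / (1 - t) = 1 + t * (1 - c) / (1 - t)\<close> with
  \<open>t = z i * cnj (z j)\<close> and \<open>c = b i * cnj (b j)\<close>. The constant 1 produces
  the squared sum, and node \<open>k\<close> drops out of the rest because
  \<open>z k = 0\<close>.\<close>

lemma herm_form_pick_reduce:
  assumes fin: "finite A" and k: "k \<notin> A" "z k = 0" "a k = 0"
    and z: "\<And>i. i \<in> A \<Longrightarrow> norm (z i) < 1" and a: "\<And>i. i \<in> A \<Longrightarrow> a i = z i * b i"
  shows "herm_form (pick z a) (insert k A) y =
    of_real ((norm (\<Sum>i\<in>insert k A. y i))\<^sup>2) + herm_form (pick z b) A (\<lambda>i. z i * y i)"
proof -
  let ?I = "insert k A"
  have p: "pick z a i j = 1 + z i * cnj (z j) * pick z b i j" if "i \<in> ?I" "j \<in> ?I" for i j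
  proof -
    have "norm (z i) < 1" "norm (z j) < 1" using that z k by auto
    then have "1 - z i * cnj (z j) \<noteq> 0" using one_minus_cnj_mult_nonzero by blast
    moreover have "a i = z i * b i" "a j = z j * b j" using that a k by auto
    ultimately show ?thesis by (simp add: pick_def field_simps)
  qed
  have "herm_form (pick z a) ?I y =
      (\<Sum>i\<in>?I. \<Sum>j\<in>?I. y i * cnj (y j) + (z i * y i) * cnj (z j * y j) * pick z b i j)"
    unfolding herm_form_def by (intro sum.cong refl) (simp add: p algebra_simps)
  also have "\<dots> = (\<Sum>i\<in>?I. y i) * cnj (\<Sum>i\<in>?I. y i) + herm_form (pick z b) ?I (\<lambda>i. z i * y i)"
    by (simp only: sum.distrib herm_form_def sum_product cnj_sum)
  also have "herm_form (pick z b) ?I (\<lambda>i. z i * y i) = herm_form (pick z b) A (\<lambda>i. z i * y i)"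
    unfolding herm_form_def using fin k by simp
  finally show ?thesis by (simp only: complex_norm_square)
qed

section \<open>The Schur algorithm and the Nevanlinna--Pick theorem\<close>

text \<open>Composing \<open>f\<close> with Moebius maps on both sides gives a self-map of the disc
  fixing 0; by the Schwarz lemma its quotient by \<open>w\<close> is still bounded by 1.\<close>

lemma Schur_step_division:
  assumes f: "f holomorphic_on ball 0 1" "\<And>w. norm w < 1 \<Longrightarrow> norm (f w) < 1"
    and \<zeta>: "norm \<zeta> < 1"
  obtains h where "h holomorphic_on ball 0 1" "\<And>w. norm w < 1 \<Longrightarrow> norm (h w) \<le> 1"
    "\<And>w. norm w < 1 \<Longrightarrow> Moebius_function 0 (f \<zeta>) (f w) =
      Moebius_function 0 \<zeta> w * h (Moebius_function 0 \<zeta> w)"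
proof -
  define F where "F = (\<lambda>w. Moebius_function 0 (f \<zeta>) (f (Moebius_function 0 (-\<zeta>) w)))"
  have M\<zeta>: "norm (Moebius_function 0 (-\<zeta>) w) < 1" if "norm w < 1" for w
    using that \<zeta> by (intro Moebius_function_norm_lt_1) auto
  have F1: "norm (F w) < 1" if "norm w < 1" for w
    unfolding F_def using that \<zeta> M\<zeta> by (intro Moebius_function_norm_lt_1 f) auto
  have F0: "F 0 = 0"
    by (simp add: F_def Moebius_function_of_zero Moebius_function_eq_zero)
  have "(Moebius_function 0 (f \<zeta>) \<circ> (f \<circ> Moebius_function 0 (-\<zeta>))) holomorphic_on ball 0 1"
    by (intro holomorphic_on_compose_gen[where t = "ball 0 1"] f Moebius_function_holomorphic)
       (use \<zeta> f M\<zeta> in \<open>auto simp: o_def\<close>)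
  then have Fhol: "F holomorphic_on ball 0 1" by (simp add: F_def o_def)
  obtain h where h: "h holomorphic_on ball 0 1" "\<And>w. norm w < 1 \<Longrightarrow> F w = w * h w" "deriv F 0 = h 0"
    using Schwarz3[OF Fhol F0] by blast
  show ?thesis
  proof
    show "norm (h w) \<le> 1" if "norm w < 1" for w
    proof (cases "w = 0")
      case True
      then show ?thesis using Schwarz_Lemma(2)[OF Fhol F0 F1 that] h by simp
    next
      case False
      have "norm (F w) \<le> norm w" using Schwarz_Lemma(1)[OF Fhol F0 F1 that] .
      then show ?thesis using False h(2)[OF that] by (simp add: norm_mult)
    qed
    show "Moebius_function 0 (f \<zeta>) (f w) = Moebius_function 0 \<zeta> w * h (Moebius_function 0 \<zeta> w)"
      if w: "norm w < 1" for w
    proof -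
      have "norm (Moebius_function 0 \<zeta> w) < 1"
        using Moebius_function_norm_lt_1 \<zeta> w by blast
      from h(2)[OF this] show ?thesis
        using Moebius_function_compose[of "-\<zeta>" \<zeta> w] \<zeta> w by (simp add: F_def)
    qed
  qed (rule h(1))
qed

text \<open>
  One step of the Schur algorithm: after moving the node \<open>z k\<close> and the value \<open>a k\<close> to \<open>0\<close> by Moebius
  maps, the Pick form is a square plus the Pick form of the data \<open>b\<close> obtained by dividing the
  values by the nodes.
\<close>

lemma herm_form_pick_Schur:
  assumes "finite A" "k \<notin> A"
    and z: "\<And>i. i \<in> insert k A \<Longrightarrow> norm (z i) < 1" and a: "\<And>i. i \<in> insert k A \<Longrightarrow> norm (a i) < 1"
    and b: "\<And>i. i \<in> A \<Longrightarrow>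
      Moebius_function 0 (a k) (a i) = Moebius_function 0 (z k) (z i) * b i"
  obtains d where "\<And>i. i \<in> insert k A \<Longrightarrow> d i \<noteq> 0"
    and "\<And>y. herm_form (pick z a) (insert k A) (\<lambda>i. d i * y i) =
      of_real ((norm (\<Sum>i\<in>insert k A. y i))\<^sup>2) +
      herm_form (pick (\<lambda>i. Moebius_function 0 (z k) (z i)) b) A (\<lambda>i. Moebius_function 0 (z k) (z i) * y i)"
proof -
  let ?v = "\<lambda>i. Moebius_function 0 (z k) (z i)" and ?u = "\<lambda>i. Moebius_function 0 (a k) (a i)"
  obtain d where d: "\<And>i. i \<in> insert k A \<Longrightarrow> d i \<noteq> 0"
    "\<And>i j. i \<in> insert k A \<Longrightarrow> j \<in> insert k A \<Longrightarrow> pick ?v ?u i j = d i * cnj (d j) * pick z a i j"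
    using pick_Moebius[of "z k" "a k" "insert k A" z a] z a by blast
  show ?thesis
  proof
    show "\<And>i. i \<in> insert k A \<Longrightarrow> d i \<noteq> 0" by (fact d(1))
    fix y
    have "herm_form (pick z a) (insert k A) (\<lambda>i. d i * y i) = herm_form (pick ?v ?u) (insert k A) y"
      by (rule herm_form_cong) (simp add: d(2))
    also have "\<dots> = of_real ((norm (\<Sum>i\<in>insert k A. y i))\<^sup>2) +
        herm_form (pick ?v b) A (\<lambda>i. ?v i * y i)"
      using assms by (intro herm_form_pick_reduce)
        (auto simp: Moebius_function_eq_zero Moebius_function_norm_lt_1)
    finally show "herm_form (pick z a) (insert k A) (\<lambda>i. d i * y i) = \<dots>" .
  qed
qed

text \<open>Splitting the numerator of \<open>pick\<close> turns Pick positivity into a comparison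
  of two Szego forms. The scalar \<open>c\<close> is kept apart so that it can later tend to 1 or be
  set to \<open>1 / M\<close>.\<close>

lemma herm_form_pick_diff:
  "herm_form (pick z (\<lambda>i. c * a i)) A x =
    herm_form (pick z (\<lambda>_. 0)) A x - c * cnj c * herm_form (pick z (\<lambda>_. 0)) A (\<lambda>i. a i * x i)"
  unfolding herm_form_def sum_distrib_left sum_subtractf[symmetric]
  by (intro sum.cong refl) (simp add: pick_def diff_divide_distrib algebra_simps)

text \<open>Each Schur step removes one node and leaves a square plus the form of the quotient
  function at the moved nodes; hence the induction generalises over nodes and function.\<close>

theorem pick_nonneg_of_interpolation:
  assumes "finite A" "\<And>i. i \<in> A \<Longrightarrow> norm (z i) < 1"
    and "f holomorphic_on ball 0 1" "\<And>w. norm w < 1 \<Longrightarrow> norm (f w) \<le> 1"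
  shows "0 \<le> Re (herm_form (pick z (\<lambda>i. f (z i))) A x)"
  using assms
proof (induction A arbitrary: z f x rule: finite_induct)
  case empty
  then show ?case by (simp add: herm_form_def)
next
  case (insert k A)
  \<comment> \<open>The Moebius normalisation needs values strictly inside the disc, which
    \<open>s < 1\<close> guarantees; afterwards \<open>s\<close> tends to 1.\<close>
  have strict: "0 \<le> Re (herm_form (pick z (\<lambda>i. of_real s * f (z i))) (insert k A) x)" if s: "0 < s" "s < 1" for s :: real
  proof -
    define g where "g w = of_real s * f w" for w
    have g: "g holomorphic_on ball 0 1" unfolding g_def
      by (intro holomorphic_intros insert.prems)
    have g1: "norm (g w) < 1" if "norm w < 1" for w
    proof -
      have "norm (g w) \<le> s * 1" unfolding g_def norm_mult
        using s insert.prems(3)[OF that] by (intro mult_mono) auto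
      then show ?thesis using s by simp
    qed
    have zk: "norm (z k) < 1" using insert.prems by simp
    obtain h where h: "h holomorphic_on ball 0 1" "\<And>w. norm w < 1 \<Longrightarrow> norm (h w) \<le> 1"
      "\<And>w. norm w < 1 \<Longrightarrow> Moebius_function 0 (g (z k)) (g w) =
        Moebius_function 0 (z k) w * h (Moebius_function 0 (z k) w)"
      using Schur_step_division[OF g g1 zk] by blast
    let ?v = "\<lambda>i. Moebius_function 0 (z k) (z i)"
    obtain d where d: "\<And>i. i \<in> insert k A \<Longrightarrow> d i \<noteq> 0"
      "\<And>y. herm_form (pick z (\<lambda>i. g (z i))) (insert k A) (\<lambda>i. d i * y i) =
        of_real ((norm (\<Sum>i\<in>insert k A. y i))\<^sup>2) +
        herm_form (pick ?v (\<lambda>i. h (?v i))) A (\<lambda>i. ?v i * y i)"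
      using herm_form_pick_Schur[of A k z "\<lambda>i. g (z i)" "\<lambda>i. h (?v i)"] insert.hyps insert.prems(1) g1 h(3)
      by auto
    have "herm_form (pick z (\<lambda>i. g (z i))) (insert k A) x =
        herm_form (pick z (\<lambda>i. g (z i))) (insert k A) (\<lambda>i. d i * (x i / d i))"
      by (rule herm_form_cong) (use d(1) in auto)
    moreover have "0 \<le> Re (herm_form (pick ?v (\<lambda>i. h (?v i))) A (\<lambda>i. ?v i * (x i / d i)))"
      using insert.prems by (intro insert.IH h Moebius_function_norm_lt_1) auto
    ultimately show ?thesis unfolding g_def[symmetric] d(2) by simp
  qed
  define P where "P = Re (herm_form (pick z (\<lambda>_. 0)) (insert k A) x)"
  define Q where "Q = Re (herm_form (pick z (\<lambda>_. 0)) (insert k A) (\<lambda>i. f (z i) * x i))"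
  have Re_eq: "Re (herm_form (pick z (\<lambda>i. of_real s * f (z i))) (insert k A) x) = P - s * s * Q" for s :: real
    unfolding herm_form_pick_diff P_def Q_def by simp
  have "((\<lambda>s. P - s * s * Q) \<longlongrightarrow> P - 1 * 1 * Q) (at_left (1::real))"
    by (intro tendsto_intros)
  moreover have "eventually (\<lambda>s. 0 \<le> P - s * s * Q) (at_left (1::real))"
    unfolding eventually_at_left_field using strict Re_eq by (intro exI[of _ 0]) auto
  ultimately have "0 \<le> P - 1 * 1 * Q"
    by (rule tendsto_lowerbound) simp
  then show ?case using Re_eq[of 1] by simp
qed

text \<open>The Schur step is run backwards: the reduced data again have a positive form, and a
  solution for them is multiplied by the Moebius factor and moved back.\<close>

theorem interpolation_of_pick_positive:
  assumes "finite A" "\<And>i. i \<in> A \<Longrightarrow> norm (z i) < 1" "inj_on z A"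
    and "\<And>x. (\<exists>i\<in>A. x i \<noteq> 0) \<Longrightarrow> 0 < Re (herm_form (pick z a) A x)"
  shows "\<exists>F. F holomorphic_on ball 0 1 \<and> (\<forall>w. norm w < 1 \<longrightarrow> norm (F w) < 1) \<and> (\<forall>i\<in>A. F (z i) = a i)"
  using assms
proof (induction A arbitrary: z a rule: finite_induct)
  case empty
  show ?case by (intro exI[of _ "\<lambda>_. 0"]) auto
next
  case (insert k A)
  note pos = insert.prems(3)
  have z1: "norm (z i) < 1" if "i \<in> insert k A" for i using insert.prems(1) that by simp
  have a1: "norm (a i) < 1" if i: "i \<in> insert k A" for i
  proof -
    have fin: "finite (insert k A)" using insert.hyps by simp
    \<comment> \<open>Testing with the \<open>i\<close>-th unit vector isolates the diagonal entry,
      whose positivity forces \<open>norm (a i) < 1\<close>.\<close>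
    have "herm_form (pick z a) (insert k A) (\<lambda>j. if j = i then 1 else 0) =
      (\<Sum>l\<in>insert k A. if l = i then \<Sum>j\<in>insert k A. if j = i then pick z a i i else 0 else 0)"
      unfolding herm_form_def by (intro sum.cong refl) (auto intro!: sum.cong)
    also have "\<dots> = pick z a i i" using i fin by (simp only: sum.delta' sum.delta if_True)
    also have "\<dots> = of_real ((1 - (norm (a i))\<^sup>2) / (1 - (norm (z i))\<^sup>2))"
      unfolding pick_def by (simp flip: complex_norm_square)
    finally have "0 < (1 - (norm (a i))\<^sup>2) / (1 - (norm (z i))\<^sup>2)"
      using pos[of "\<lambda>j. if j = i then 1 else 0"] i by auto
    moreover have "0 < 1 - (norm (z i))\<^sup>2" using z1[OF i] by (simp add: abs_square_less_1)
    ultimately have "(norm (a i))\<^sup>2 < 1" by (simp add: zero_less_divide_iff)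
    then show ?thesis by (simp add: abs_square_less_1)
  qed
  let ?v = "\<lambda>i. Moebius_function 0 (z k) (z i)" and ?u = "\<lambda>i. Moebius_function 0 (a k) (a i)"
  have zk: "norm (z k) < 1" and ak: "norm (a k) < 1" using z1 a1 by auto
  have inj_v: "z i = z j" if "?v i = ?v j" "i \<in> insert k A" "j \<in> insert k A" for i j
    using Moebius_function_compose[of "- z k" "z k"] zk that z1 by (metis minus_minus norm_minus_cancel)
  have v0: "?v i \<noteq> 0" if "i \<in> A" for i
    using inj_v[of i k] that insert.hyps insert.prems(2) Moebius_function_eq_zero[of 0 "z k"]
    by (auto simp: inj_on_def)
  define b where "b i = ?u i / ?v i" for i
  obtain d where d: "\<And>i. i \<in> insert k A \<Longrightarrow> d i \<noteq> 0"
    "\<And>y. herm_form (pick z a) (insert k A) (\<lambda>i. d i * y i) =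
      of_real ((norm (\<Sum>i\<in>insert k A. y i))\<^sup>2) + herm_form (pick ?v b) A (\<lambda>i. ?v i * y i)"
    using herm_form_pick_Schur[of A k z a b] insert.hyps z1 a1 v0 by (auto simp: b_def)
  have "\<exists>F. F holomorphic_on ball 0 1 \<and> (\<forall>w. norm w < 1 \<longrightarrow> norm (F w) < 1) \<and> (\<forall>i\<in>A. F (?v i) = b i)"
  proof (rule insert.IH)
    show "norm (?v i) < 1" if "i \<in> A" for i
      using that z1 zk by (simp add: Moebius_function_norm_lt_1)
    show "inj_on ?v A"
      using inj_v insert.prems(2) by (auto simp: inj_on_def)
    fix x :: "'a \<Rightarrow> complex" assume x: "\<exists>i\<in>A. x i \<noteq> 0"
    \<comment> \<open>The free coordinate at \<open>k\<close> makes the total sum zero, so the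
      square disappears and only the reduced form at \<open>x\<close> is left.\<close>
    define y where "y i = (if i = k then - (\<Sum>i\<in>A. x i / ?v i) else x i / ?v i)" for i
    have yA: "(\<Sum>i\<in>A. y i) = (\<Sum>i\<in>A. x i / ?v i)"
      using insert.hyps by (intro sum.cong) (auto simp: y_def)
    have "(\<Sum>i\<in>insert k A. y i) = 0"
      using insert.hyps yA by (simp add: y_def)
    moreover have "herm_form (pick ?v b) A (\<lambda>i. ?v i * y i) = herm_form (pick ?v b) A x"
      using insert.hyps v0 by (intro herm_form_cong) (auto simp: y_def)
    moreover have "0 < Re (herm_form (pick z a) (insert k A) (\<lambda>i. d i * y i))"
    proof (rule pos)
      obtain i where "i \<in> A" "x i \<noteq> 0" using x by blast
      then show "\<exists>i\<in>insert k A. d i * y i \<noteq> 0"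
        using d(1) v0 insert.hyps by (intro bexI[of _ i]) (auto simp: y_def)
    qed
    ultimately show "0 < Re (herm_form (pick ?v b) A x)" by (simp add: d(2))
  qed
  then obtain G where G: "G holomorphic_on ball 0 1" "\<And>w. norm w < 1 \<Longrightarrow> norm (G w) < 1"
    "\<And>i. i \<in> A \<Longrightarrow> G (?v i) = b i" by blast
  \<comment> \<open>\<open>H\<close> takes the values \<open>?u i\<close> at the nodes; at
    \<open>z k\<close> its first factor vanishes, matching \<open>?u k = 0\<close>.\<close>
  define H where "H w = Moebius_function 0 (z k) w * G (Moebius_function 0 (z k) w)" for w
  have M1: "norm (Moebius_function 0 (z k) w) < 1" if "norm w < 1" for w
    using that zk by (simp add: Moebius_function_norm_lt_1)
  have H1: "norm (H w) < 1" if "norm w < 1" for w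
    unfolding H_def using norm_mult_less[OF M1[OF that] G(2)[OF M1[OF that]]] by simp
  have "(\<lambda>w. Moebius_function 0 (z k) w * (G \<circ> Moebius_function 0 (z k)) w) holomorphic_on ball 0 1"
    by (intro holomorphic_on_mult holomorphic_on_compose_gen[where t = "ball 0 1"] G
        Moebius_function_holomorphic zk) (use M1 in auto)
  then have Hhol: "H holomorphic_on ball 0 1" by (simp add: H_def[abs_def] o_def)
  define F where "F = Moebius_function 0 (- a k) \<circ> H"
  show ?case
  proof (intro exI conjI allI impI ballI)
    show "F holomorphic_on ball 0 1" unfolding F_def
      by (intro holomorphic_on_compose_gen[where t = "ball 0 1"] Hhol Moebius_function_holomorphic)
         (use ak H1 in auto)
    show "norm (F w) < 1" if "norm w < 1" for w
      unfolding F_def o_def using ak H1[OF that] by (intro Moebius_function_norm_lt_1) auto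
    show "F (z i) = a i" if "i \<in> insert k A" for i
    proof (cases "i = k")
      case True
      then show ?thesis by (simp add: F_def H_def Moebius_function_eq_zero Moebius_function_of_zero)
    next
      case False
      then have "i \<in> A" using that by simp
      then have "H (z i) = ?u i" using G(3) v0 by (simp add: H_def b_def)
      then show ?thesis
        using Moebius_function_compose[of "- a k" "a k" "a i"] ak a1[OF that] by (simp add: F_def)
    qed
  qed
qed

section \<open>Diagonal bounds for Gram matrices that are close to the identity on tails\<close>

text \<open>A finite set whose sum is within \<open>\<epsilon>\<close> of the supremum leaves at
  most \<open>\<epsilon>\<close> for any finite set beyond it.\<close>

lemma tail_sums_small:
  fixes f :: "nat \<Rightarrow> real"
  assumes f: "\<And>j. 0 \<le> f j" and C: "\<And>A. finite A \<Longrightarrow> A \<subseteq> {N..} \<Longrightarrow> sum f A \<le> C" and "0 < \<epsilon>"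
  shows "\<exists>N'\<ge>N. \<forall>A. finite A \<longrightarrow> A \<subseteq> {N'..} \<longrightarrow> sum f A \<le> \<epsilon>"
proof -
  define \<A> where "\<A> = {A. finite A \<and> A \<subseteq> {N..}}"
  define S where "S = (SUP A\<in>\<A>. sum f A)"
  have ne: "\<A> \<noteq> {}" by (auto simp: \<A>_def)
  have bdd: "bdd_above (sum f ` \<A>)"
    using C by (auto simp: \<A>_def intro!: bdd_aboveI[of _ C])
  obtain A0 where A0: "A0 \<in> \<A>" "S - \<epsilon> < sum f A0"
    using less_cSUP_iff[OF ne bdd, of "S - \<epsilon>"] \<open>0 < \<epsilon>\<close> unfolding S_def by auto
  define N' where "N' = max N (Suc (Max (insert 0 A0)))"
  show ?thesis
  proof (intro exI[of _ N'] conjI allI impI)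
    show "N \<le> N'" by (simp add: N'_def)
    fix A assume A: "finite A" "A \<subseteq> {N'..}"
    have "j < N'" if "j \<in> A0" for j
    proof -
      have "j \<le> Max (insert 0 A0)" using that A0 by (intro Max_ge) (auto simp: \<A>_def)
      then show ?thesis by (simp add: N'_def)
    qed
    then have dis: "A0 \<inter> A = {}" using A by fastforce
    have "A0 \<union> A \<in> \<A>" using A0 A \<open>N \<le> N'\<close> by (auto simp: \<A>_def)
    then have "sum f (A0 \<union> A) \<le> S" unfolding S_def by (intro cSUP_upper bdd)
    then show "sum f A \<le> \<epsilon>"
      using dis A A0 by (simp add: sum.union_disjoint \<A>_def)
  qed
qed

text \<open>
  Attaching block \<open>k\<close> costs \<open>c / 2^(k+2)\<close> on every coordinate attached so far, so a coordinate of
  block \<open>l\<close> pays at most the geometric tail \<open>c / 2^(l+1)\<close>, which vanishes as \<open>l\<close> grows.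
\<close>

lemma block_recursion_lower_bound:
  fixes q :: "nat set \<Rightarrow> real" and N :: "nat \<Rightarrow> nat"
  assumes N: "strict_mono N" and w: "\<And>j. 0 \<le> w j"
    and base: "\<And>A. A \<subseteq> {..<N 0} \<Longrightarrow> s * sum w A \<le> q A"
    and step: "\<And>k A T. A \<subseteq> {..<N k} \<Longrightarrow> T \<subseteq> {N k..<N (Suc k)} \<Longrightarrow>
      q A + \<kappa> * sum w T - c * (1/2)^(k+2) * sum w (A \<union> T) \<le> q (A \<union> T)"
    and "finite A" and "0 \<le> c"
  shows "(\<Sum>j\<in>A. ((if j < N 0 then s else \<kappa>) - c * (1/2)^(Suc (LEAST i. j < N (Suc i)))) * w j) \<le> q A"
proof -
  define L where "L j = (LEAST i. j < N (Suc i))" for j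
  define e where "e j = (if j < N 0 then s else \<kappa>) - c * (1/2)^(Suc (L j))" for j
  have L0: "L j = 0" if "j < N 0" for j
    unfolding L_def using that N by (intro Least_equality) (auto simp: strict_mono_def intro: less_trans)
  have Lk: "L j = k" if "N k \<le> j" "j < N (Suc k)" for j k
    unfolding L_def
  proof (rule Least_equality)
    fix i assume "j < N (Suc i)"
    then have "N k < N (Suc i)" using that by simp
    then show "k \<le> i" using N by (simp add: strict_mono_less)
  qed (use that in simp)
  \<comment> \<open>All costs are already deducted in \<open>e j\<close>; the term
    \<open>c * (1/2)^(Suc k)\<close> gives back what blocks \<open>k\<close>, \<open>k + 1\<close>
    and so on have not yet charged.\<close>
  have main: "A \<subseteq> {..<N k} \<Longrightarrow> (\<Sum>j\<in>A. (e j + c * (1/2)^(Suc k)) * w j) \<le> q A" for k A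
  proof (induction k arbitrary: A)
    case 0
    have "(\<Sum>j\<in>A. (e j + c * (1/2)^(Suc 0)) * w j) = (\<Sum>j\<in>A. s * w j)"
      using 0 by (intro sum.cong) (auto simp: e_def L0)
    then show ?case using base[OF 0] by (simp add: sum_distrib_left)
  next
    case (Suc k)
    define B where "B = A \<inter> {..<N k}"
    define T where "T = A \<inter> {N k..<N (Suc k)}"
    have AB: "A = B \<union> T" "B \<inter> T = {}" "finite B" "finite T"
      using Suc.prems by (auto simp: B_def T_def)
    have "N 0 \<le> N k" using N by (simp add: strict_mono_less_eq)
    have B: "(\<Sum>j\<in>B. (e j + c * (1/2)^(Suc (Suc k))) * w j)
        = (\<Sum>j\<in>B. (e j + c * (1/2)^(Suc k)) * w j) - c * (1/2)^(k+2) * sum w B"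
      unfolding sum_distrib_left sum_subtractf[symmetric]
      by (intro sum.cong refl) (simp add: algebra_simps)
    have "(\<Sum>j\<in>T. (e j + c * (1/2)^(Suc (Suc k))) * w j) = (\<Sum>j\<in>T. (\<kappa> - c * (1/2)^(k+2)) * w j)"
    proof (intro sum.cong refl)
      fix j assume "j \<in> T"
      then have "L j = k" "\<not> j < N 0" using Lk[of k j] \<open>N 0 \<le> N k\<close> by (auto simp: T_def)
      then show "(e j + c * (1/2)^(Suc (Suc k))) * w j = (\<kappa> - c * (1/2)^(k+2)) * w j"
        by (simp add: e_def)
    qed
    then have T: "(\<Sum>j\<in>T. (e j + c * (1/2)^(Suc (Suc k))) * w j) = \<kappa> * sum w T - c * (1/2)^(k+2) * sum w T"
      by (simp only: sum_distrib_left left_diff_distrib sum_subtractf)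
    have "(\<Sum>j\<in>A. (e j + c * (1/2)^(Suc (Suc k))) * w j)
        = (\<Sum>j\<in>B. (e j + c * (1/2)^(Suc k)) * w j) + \<kappa> * sum w T - c * (1/2)^(k+2) * sum w A"
    proof -
      have "sum f A = sum f B + sum f T" for f :: "nat \<Rightarrow> real"
        using AB by (simp add: sum.union_disjoint)
      note split = this[of w] this[of "\<lambda>j. (e j + c * (1/2)^(Suc (Suc k))) * w j"]
      show ?thesis unfolding split B T distrib_left by linarith
    qed
    also have "\<dots> \<le> q B + \<kappa> * sum w T - c * (1/2)^(k+2) * sum w A"
      using Suc.IH[of B] by (simp add: B_def)
    also have "\<dots> \<le> q A"
    proof -
      have "B \<subseteq> {..<N k}" "T \<subseteq> {N k..<N (Suc k)}" by (auto simp: B_def T_def)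
      from step[OF this] show ?thesis unfolding AB(1)[symmetric] .
    qed
    finally show ?case .
  qed
  obtain k where k: "A \<subseteq> {..<N k}"
  proof
    have "j < N (Suc (Max (insert 0 A)))" if "j \<in> A" for j
    proof -
      have "j \<le> Max (insert 0 A)" using that assms by (intro Max_ge) auto
      also have "\<dots> < N (Suc (Max (insert 0 A)))"
        using strict_mono_imp_increasing[OF N, of "Suc (Max (insert 0 A))"] by simp
      finally show ?thesis .
    qed
    then show "A \<subseteq> {..<N (Suc (Max (insert 0 A)))}" by auto
  qed
  have "(\<Sum>j\<in>A. e j * w j) \<le> (\<Sum>j\<in>A. (e j + c * (1/2)^(Suc k)) * w j)"
    using w \<open>0 \<le> c\<close> by (intro sum_mono mult_right_mono) auto
  then show ?thesis using main[OF k] by (simp add: e_def L_def)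
qed

section \<open>Forms of Gram matrices with unit diagonal\<close>

locale gram_matrix =
  fixes g :: "nat \<Rightarrow> nat \<Rightarrow> complex"
  assumes hermitian: "g j i = cnj (g i j)"
    and diag: "g i i = 1"
    and psd: "finite A \<Longrightarrow> 0 \<le> Re (herm_form g A x)"
begin

definition "q A x = Re (herm_form g A x)"
definition "nrm A x = (\<Sum>i\<in>A. (norm (x i :: complex))\<^sup>2)"
definition "cross A B x = Re (\<Sum>i\<in>A. \<Sum>j\<in>B. x i * cnj (x j) * g i j)"

lemma q_nonneg: "finite A \<Longrightarrow> 0 \<le> q A x"
  using psd by (simp add: q_def)

lemma nrm_nonneg: "0 \<le> nrm A x"
  by (simp add: nrm_def sum_nonneg)

lemma nrm_Un: "finite A \<Longrightarrow> finite B \<Longrightarrow> A \<inter> B = {} \<Longrightarrow> nrm (A \<union> B) x = nrm A x + nrm B x"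
  by (simp add: nrm_def sum.union_disjoint)

lemma q_Un:
  assumes "finite A" "finite B" "A \<inter> B = {}"
  shows "q (A \<union> B) x = q A x + q B x + 2 * cross A B x"
proof -
  have "(\<Sum>i\<in>B. \<Sum>j\<in>A. x i * cnj (x j) * g i j) = (\<Sum>j\<in>A. \<Sum>i\<in>B. x i * cnj (x j) * g i j)"
    by (rule sum.swap)
  also have "\<dots> = cnj (\<Sum>i\<in>A. \<Sum>j\<in>B. x i * cnj (x j) * g i j)"
    unfolding cnj_sum
  proof (intro sum.cong refl)
    fix i j
    show "x j * cnj (x i) * g j i = cnj (x i * cnj (x j) * g i j)"
      unfolding hermitian[of j i] by simp
  qed
  finally have "Re (\<Sum>i\<in>B. \<Sum>j\<in>A. x i * cnj (x j) * g i j) = cross A B x"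
    unfolding cross_def by (simp only: cnj.sel)
  then show ?thesis
    using assms unfolding q_def herm_form_def cross_def
    by (simp add: sum.union_disjoint sum.distrib)
qed

text \<open>Scaling only the \<open>A\<close> part of the vector scales the cross term linearly.
  Suitable values of \<open>s\<close> then bound cross terms by the two diagonal parts.\<close>

lemma q_scaled_nonneg:
  assumes "finite A" "finite B" "A \<inter> B = {}"
  shows "0 \<le> s\<^sup>2 * q A x + q B x + 2 * s * cross A B x"
proof -
  define y where "y i = (if i \<in> A then of_real s * x i else x i)" for i
  have "herm_form g A y = of_real (s\<^sup>2) * herm_form g A x"
    unfolding herm_form_def sum_distrib_left
    by (intro sum.cong refl) (simp add: y_def power2_eq_square mult_ac)
  then have "q A y = s\<^sup>2 * q A x" unfolding q_def by simp
  moreover have "herm_form g B y = herm_form g B x"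
    using assms by (intro herm_form_cong) (auto simp: y_def)
  then have "q B y = q B x" by (simp add: q_def)
  moreover have "(\<Sum>i\<in>A. \<Sum>j\<in>B. y i * cnj (y j) * g i j) = of_real s * (\<Sum>i\<in>A. \<Sum>j\<in>B. x i * cnj (x j) * g i j)"
    unfolding sum_distrib_left using assms by (intro sum.cong refl) (auto simp: y_def)
  then have "cross A B y = s * cross A B x" unfolding cross_def by simp
  ultimately show ?thesis
    using q_nonneg[of "A \<union> B" y] q_Un[OF assms, of y] assms by simp
qed

lemma q_singleton: "q {k} x = (norm (x k))\<^sup>2"
  by (simp add: q_def herm_form_def diag flip: complex_norm_square)

text \<open>
  The signs are chosen greedily, one coordinate at a time, so that each new cross term has the
  required sign. This replaces averaging over all sign choices.
\<close>

lemma ex_signs: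
  assumes "finite A" "\<kappa> = 1 \<or> \<kappa> = -1"
  shows "\<exists>s::nat \<Rightarrow> real. (\<forall>i. s i = 1 \<or> s i = -1) \<and> \<kappa> * nrm A x \<le> \<kappa> * q A (\<lambda>i. of_real (s i) * x i)"
  using assms(1)
proof (induction A rule: finite_induct)
  case empty
  show ?case by (intro exI[of _ "\<lambda>_. 1"]) (simp add: nrm_def q_def herm_form_def)
next
  case (insert k A)
  then obtain s where s: "\<forall>i. s i = 1 \<or> s i = -1" "\<kappa> * nrm A x \<le> \<kappa> * q A (\<lambda>i. of_real (s i) * x i)"
    by blast
  define C where "C = Re (\<Sum>i\<in>A. of_real (s i) * x i * cnj (x k) * g i k)"
  define t :: real where "t = (if 0 \<le> \<kappa> * C then 1 else -1)"
  have t: "t = 1 \<or> t = -1" "0 \<le> \<kappa> * (t * C)" by (auto simp: t_def)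
  let ?y = "\<lambda>i. of_real ((s(k := t)) i) * x i"
  have "herm_form g A ?y = herm_form g A (\<lambda>i. of_real (s i) * x i)"
    using insert.hyps by (intro herm_form_cong) auto
  then have "q A ?y = q A (\<lambda>i. of_real (s i) * x i)" by (simp add: q_def)
  moreover have "(\<Sum>i\<in>A. \<Sum>j\<in>{k}. ?y i * cnj (?y j) * g i j) =
      of_real t * (\<Sum>i\<in>A. of_real (s i) * x i * cnj (x k) * g i k)"
    unfolding sum_distrib_left using insert.hyps by (intro sum.cong) auto
  then have "cross A {k} ?y = t * C" unfolding cross_def C_def by simp
  moreover have "q {k} ?y = (norm (x k))\<^sup>2"
    using t by (auto simp: q_singleton norm_mult)
  ultimately have "q (insert k A) ?y = q A (\<lambda>i. of_real (s i) * x i) + (norm (x k))\<^sup>2 + 2 * (t * C)"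
    using q_Un[of A "{k}" ?y] insert.hyps by simp
  moreover have "nrm (insert k A) x = nrm A x + (norm (x k))\<^sup>2"
    using insert.hyps by (simp add: nrm_def)
  ultimately have "\<kappa> * nrm (insert k A) x \<le> \<kappa> * q (insert k A) ?y"
    using s(2) t(2) by (simp add: distrib_left)
  then show ?case using s(1) t(1) by (intro exI[of _ "s(k := t)"]) (metis fun_upd_apply)
qed

text \<open>One choice of signs raises the form to at least \<open>nrm A x\<close>, another lowers
  it to at most \<open>nrm A x\<close>. As sign changes are involutions, the one-sided assumption
  \<open>M\<close> yields both bounds.\<close>

lemma sign_invariance_bounds:
  assumes "finite A" "0 \<le> M"
    and M: "\<And>s x. (\<And>i. s i = 1 \<or> s i = -1) \<Longrightarrow> q A (\<lambda>i. of_real (s i) * x i) \<le> M * q A x"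
  shows "nrm A x \<le> M * q A x" "q A x \<le> M * nrm A x"
proof -
  obtain s :: "nat \<Rightarrow> real" where "\<forall>i. s i = 1 \<or> s i = -1" "nrm A x \<le> q A (\<lambda>i. of_real (s i) * x i)"
    using ex_signs[OF assms(1), of 1 x] by auto
  then show "nrm A x \<le> M * q A x" using M[of s x] by auto
  obtain s :: "nat \<Rightarrow> real" where s: "\<And>i. s i = 1 \<or> s i = -1" "q A (\<lambda>i. of_real (s i) * x i) \<le> nrm A x"
    using ex_signs[OF assms(1), of "-1" x] by auto
  have ss: "of_real (s i) * (of_real (s i) * x i) = x i" for i
    using s(1)[of i] by auto
  have "q A x \<le> M * q A (\<lambda>i. of_real (s i) * x i)"
    using M[of s "\<lambda>i. of_real (s i) * x i"] s(1) by (simp add: ss)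
  also have "\<dots> \<le> M * nrm A x" using s(2) \<open>0 \<le> M\<close> by (rule mult_left_mono)
  finally show "q A x \<le> M * nrm A x" .
qed

text \<open>Cauchy--Schwarz against the unit vector of index \<open>i\<close>: positivity is tested
  after subtracting the projection, that is, with coefficient \<open>- c\<close> at
  \<open>i\<close>.\<close>

lemma cauchy_schwarz_unit:
  assumes "finite A" "i \<notin> A"
  shows "(norm (\<Sum>j\<in>A. x j * g j i))\<^sup>2 \<le> q A x"
proof -
  define c where "c = (\<Sum>j\<in>A. x j * g j i)"
  let ?y = "x(i := - c)"
  have "herm_form g A ?y = herm_form g A x"
    using assms by (intro herm_form_cong) auto
  then have "q A ?y = q A x" by (simp add: q_def)
  moreover have "(\<Sum>k\<in>A. \<Sum>j\<in>{i}. ?y k * cnj (?y j) * g k j) = - (cnj c * c)"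
  proof -
    have "(\<Sum>k\<in>A. \<Sum>j\<in>{i}. ?y k * cnj (?y j) * g k j) = (\<Sum>k\<in>A. - cnj c * (x k * g k i))"
      using assms by (intro sum.cong) auto
    also have "\<dots> = - cnj c * c" unfolding sum_distrib_left[symmetric] c_def[symmetric] ..
    finally show ?thesis by simp
  qed
  then have "cross A {i} ?y = Re (- (cnj c * c))"
    unfolding cross_def by (simp only:)
  then have "cross A {i} ?y = - (norm c)\<^sup>2"
    unfolding cmod_power2 by (simp add: power2_eq_square)
  moreover have "q {i} ?y = (norm c)\<^sup>2" by (simp add: q_singleton)
  ultimately have "q (insert i A) ?y = q A x - (norm c)\<^sup>2"
    using q_Un[of A "{i}" ?y] assms by simp
  then show ?thesis using q_nonneg[of "insert i A" ?y] assms by (simp add: c_def)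
qed

text \<open>Choosing the conjugated row as \<open>x\<close> in Cauchy--Schwarz gives
  \<open>S * S \<le> C * S\<close> for its square sum \<open>S\<close>.\<close>

lemma row_bound:
  assumes "finite A" "i \<notin> A" "0 \<le> C" and C: "\<And>x. q A x \<le> C * nrm A x"
  shows "(\<Sum>j\<in>A. (norm (g j i))\<^sup>2) \<le> C"
proof -
  define S where "S = (\<Sum>j\<in>A. (norm (g j i))\<^sup>2)"
  have "(\<Sum>j\<in>A. cnj (g j i) * g j i) = of_real S"
    unfolding S_def of_real_sum by (intro sum.cong refl) (simp only: complex_norm_square mult.commute)
  then have "S\<^sup>2 \<le> q A (\<lambda>j. cnj (g j i))"
    using cauchy_schwarz_unit[OF assms(1,2), of "\<lambda>j. cnj (g j i)"] by simp
  also have "\<dots> \<le> C * S" using C[of "\<lambda>j. cnj (g j i)"] by (simp add: nrm_def S_def)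
  finally have *: "S * S \<le> C * S" by (simp add: power2_eq_square)
  have "0 \<le> S" by (simp add: S_def sum_nonneg)
  then show ?thesis using * \<open>0 \<le> C\<close> by (cases "S = 0") (simp_all add: S_def)
qed

end

section \<open>Gram matrices whose tails approach the identity\<close>

text \<open>The constant in \<open>coordinates\<close> may depend on \<open>i\<close> but not on
  \<open>A\<close>; it prevents degeneration in the finitely many coordinates that
  \<open>tails\<close> does not cover.\<close>

locale asymptotically_orthonormal_gram = gram_matrix +
  assumes tails: "0 < \<epsilon> \<Longrightarrow> \<exists>N. \<forall>A x. finite A \<longrightarrow> A \<subseteq> {N..} \<longrightarrow> \<bar>q A x - nrm A x\<bar> \<le> \<epsilon> * nrm A x"
    and coordinates: "\<exists>C. \<forall>A x. finite A \<longrightarrow> i \<in> A \<longrightarrow> (norm (x i))\<^sup>2 \<le> C * q A x"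
begin

text \<open>Far out the form is at most \<open>2 * nrm A x\<close>, so \<open>row_bound\<close>
  bounds the square sums of each row; starting beyond \<open>i\<close> keeps the diagonal entry
  out.\<close>

lemma rows_square_summable:
  assumes "0 < \<epsilon>"
  shows "\<exists>N'. \<forall>A. finite A \<longrightarrow> A \<subseteq> {N'..} \<longrightarrow> (\<Sum>j\<in>A. (norm (g j i))\<^sup>2) \<le> \<epsilon>"
proof -
  obtain N where N: "\<And>A x. finite A \<Longrightarrow> A \<subseteq> {N..} \<Longrightarrow> \<bar>q A x - nrm A x\<bar> \<le> 1 * nrm A x"
    using tails[of 1] by auto
  have "(\<Sum>j\<in>A. (norm (g j i))\<^sup>2) \<le> 2" if A: "finite A" "A \<subseteq> {max N (Suc i)..}" for A
  proof (rule row_bound)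
    show "i \<notin> A" using A by auto
    show "q A x \<le> 2 * nrm A x" for x
    proof -
      have "A \<subseteq> {N..}" using A by auto
      from N[OF A(1) this, of x] show ?thesis by linarith
    qed
  qed (use A in auto)
  then have "\<exists>N'\<ge>max N (Suc i). \<forall>A. finite A \<longrightarrow> A \<subseteq> {N'..} \<longrightarrow> (\<Sum>j\<in>A. (norm (g j i))\<^sup>2) \<le> \<epsilon>"
    by (intro tail_sums_small[OF _ _ assms]) simp_all
  then show ?thesis by blast
qed

text \<open>Only the finitely many rows \<open>i < N\<close> occur, so one can wait until all their
  tails are small; a weighted arithmetic-geometric inequality separates \<open>A\<close> from
  \<open>T\<close>.\<close>

lemma cross_small:
  assumes "0 < \<eta>"
  shows "\<exists>N'. \<forall>A T x. A \<subseteq> {..<N} \<longrightarrow> finite T \<longrightarrow> T \<subseteq> {N'..} \<longrightarrow>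
    2 * \<bar>cross A T x\<bar> \<le> \<eta> * (nrm A x + nrm T x)"
proof -
  \<comment> \<open>The term with \<open>nrm T x\<close> is collected once per row, at most
    \<open>N\<close> times, so this weight keeps the total below \<open>\<eta>\<close>; the
    \<open>+ 1\<close> covers \<open>N = 0\<close>.\<close>
  define \<delta> where "\<delta> = \<eta> / (real N + 1)"
  have \<delta>: "0 < \<delta>" "real N * \<delta> \<le> \<eta>"
    using assms by (auto simp: \<delta>_def field_simps)
  have "\<forall>i. \<exists>N'. \<forall>A. finite A \<longrightarrow> A \<subseteq> {N'..} \<longrightarrow> (\<Sum>j\<in>A. (norm (g j i))\<^sup>2) \<le> \<delta> * \<eta>"
    using rows_square_summable \<delta> assms by auto
  then obtain R where R: "\<And>i A. finite A \<Longrightarrow> A \<subseteq> {R i..} \<Longrightarrow> (\<Sum>j\<in>A. (norm (g j i))\<^sup>2) \<le> \<delta> * \<eta>"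
    by metis
  define N' where "N' = (\<Sum>i<N. R i)"
  show ?thesis
  proof (intro exI[of _ N'] allI impI)
    fix A T x assume A: "A \<subseteq> {..<N}" and T: "finite T" "T \<subseteq> {N'..}"
    have finA: "finite A" using A finite_subset by blast
    have "2 * \<bar>cross A T x\<bar> \<le> 2 * (\<Sum>i\<in>A. \<Sum>j\<in>T. norm (x i * cnj (x j) * g i j))"
      unfolding cross_def
      by (intro mult_left_mono order_trans[OF abs_Re_le_cmod] sum_norm_le) auto
    also have "\<dots> = (\<Sum>i\<in>A. \<Sum>j\<in>T. 2 * (norm (x i) * norm (g j i)) * norm (x j))"
      unfolding sum_distrib_left
    proof (intro sum.cong refl)
      fix i j
      have "norm (g i j) = norm (g j i)" by (subst hermitian) simp
      then show "2 * norm (x i * cnj (x j) * g i j) = 2 * (norm (x i) * norm (g j i)) * norm (x j)"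
        by (simp add: norm_mult)
    qed
    also have "\<dots> \<le> (\<Sum>i\<in>A. \<Sum>j\<in>T. (norm (x i))\<^sup>2 / \<delta> * (norm (g j i))\<^sup>2 + \<delta> * (norm (x j))\<^sup>2)"
    proof (intro sum_mono)
      fix i j
      have "2 * u * v \<le> u\<^sup>2 / \<delta> + \<delta> * v\<^sup>2" for u v :: real
        using \<delta> zero_le_power2[of "u - \<delta> * v"] by (simp add: field_simps power2_eq_square)
      from this[of "norm (x i) * norm (g j i)" "norm (x j)"]
      show "2 * (norm (x i) * norm (g j i)) * norm (x j) \<le>
          (norm (x i))\<^sup>2 / \<delta> * (norm (g j i))\<^sup>2 + \<delta> * (norm (x j))\<^sup>2"
        by (simp add: power_mult_distrib)
    qed
    also have "\<dots> = (\<Sum>i\<in>A. (norm (x i))\<^sup>2 / \<delta> * (\<Sum>j\<in>T. (norm (g j i))\<^sup>2)) + real (card A) * (\<delta> * nrm T x)"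
      by (simp add: sum.distrib nrm_def sum_distrib_left)
    also have "\<dots> \<le> (\<Sum>i\<in>A. (norm (x i))\<^sup>2 / \<delta> * (\<delta> * \<eta>)) + real N * (\<delta> * nrm T x)"
    proof (intro add_mono sum_mono mult_left_mono mult_right_mono)
      fix i assume "i \<in> A"
      then have "R i \<le> N'" unfolding N'_def using A by (intro member_le_sum) auto
      then show "(\<Sum>j\<in>T. (norm (g j i))\<^sup>2) \<le> \<delta> * \<eta>" using T by (intro R) auto
    next
      show "real (card A) \<le> real N" using A card_mono[of "{..<N}" A] by simp
    qed (use \<delta> nrm_nonneg[of T x] in auto)
    also have "\<dots> = \<eta> * nrm A x + real N * \<delta> * nrm T x"
      using \<delta> by (simp add: nrm_def sum_distrib_left mult_ac)
    also have "\<dots> \<le> \<eta> * nrm A x + \<eta> * nrm T x"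
      using \<delta> nrm_nonneg by (intro add_mono mult_right_mono) auto
    finally show "2 * \<bar>cross A T x\<bar> \<le> \<eta> * (nrm A x + nrm T x)" by (simp add: distrib_left)
  qed
qed

lemma cross_Un:
  assumes "finite A" "finite B" "A \<inter> B = {}"
  shows "cross (A \<union> B) T x = cross A T x + cross B T x"
  using assms by (simp add: cross_def sum.union_disjoint)

text \<open>\<open>A\<close> is cut at a fixed \<open>Na\<close>. Below it only finitely many rows
  meet \<open>T\<close>; above it \<open>D\<close> and \<open>D \<union> T\<close> are both nearly
  orthonormal. Thus the threshold does not depend on the size of \<open>A\<close>.\<close>

lemma eventually_splits:
  assumes "0 < \<eta>"
  shows "\<exists>N0. \<forall>N\<ge>N0. \<forall>A T x. A \<subseteq> {..<N} \<longrightarrow> finite T \<longrightarrow> T \<subseteq> {N..} \<longrightarrow>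
    \<bar>q (A \<union> T) x - q A x - nrm T x\<bar> \<le> \<eta> * nrm (A \<union> T) x"
proof -
  obtain Na where Na: "\<And>A x. finite A \<Longrightarrow> A \<subseteq> {Na..} \<Longrightarrow> \<bar>q A x - nrm A x\<bar> \<le> \<eta>/4 * nrm A x"
    using tails[of "\<eta>/4"] assms by auto
  obtain Nb where Nb: "\<And>A T x. A \<subseteq> {..<Na} \<Longrightarrow> finite T \<Longrightarrow> T \<subseteq> {Nb..} \<Longrightarrow>
      2 * \<bar>cross A T x\<bar> \<le> \<eta>/4 * (nrm A x + nrm T x)"
    using cross_small[of "\<eta>/4" Na] assms by (metis zero_less_divide_iff zero_less_numeral)
  show ?thesis
  proof (intro exI[of _ "max Na Nb"] allI impI)
    fix N A T x assume N: "max Na Nb \<le> N" and A: "A \<subseteq> {..<N}" and T: "finite T" "T \<subseteq> {N..}"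
    define B where "B = A \<inter> {..<Na}"
    define D where "D = A \<inter> {Na..}"
    have "finite A" using A finite_subset by blast
    then have AB: "A = B \<union> D" "B \<inter> D = {}" "finite B" "finite D" by (auto simp: B_def D_def)
    have DT: "D \<inter> T = {}" "A \<inter> T = {}" using A T by (fastforce simp: D_def)+
    have nA: "nrm A x = nrm B x + nrm D x" using AB nrm_Un by simp
    have nDT: "nrm (D \<union> T) x = nrm D x + nrm T x" using AB T DT nrm_Un by simp
    have nAT: "nrm (A \<union> T) x = nrm A x + nrm T x" using nrm_Un[OF \<open>finite A\<close> T(1) DT(2)] .
    have qAT: "q (A \<union> T) x = q A x + q T x + 2 * (cross B T x + cross D T x)"
      using q_Un[OF \<open>finite A\<close> T(1) DT(2)] cross_Un[OF AB(3,4,2)] AB(1) by simp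
    have qDT: "q (D \<union> T) x = q D x + q T x + 2 * cross D T x"
      using q_Un AB T DT by simp
    have 2: "\<bar>q D x - nrm D x\<bar> \<le> \<eta>/4 * nrm D x" using AB by (intro Na) (auto simp: D_def)
    have 3: "\<bar>q (D \<union> T) x - nrm (D \<union> T) x\<bar> \<le> \<eta>/4 * nrm (D \<union> T) x"
      using AB T N by (intro Na) (auto simp: D_def)
    have 4: "2 * \<bar>cross B T x\<bar> \<le> \<eta>/4 * (nrm B x + nrm T x)"
      using T N by (intro Nb) (auto simp: B_def)
    define b d t where "b = \<eta> * nrm B x" and "d = \<eta> * nrm D x" and "t = \<eta> * nrm T x"
    have pos: "0 \<le> b" "0 \<le> d" "0 \<le> t" using assms nrm_nonneg[of B x] nrm_nonneg[of D x] nrm_nonneg[of T x]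
      by (simp_all add: b_def d_def t_def)
    have 2: "\<bar>q D x - nrm D x\<bar> \<le> d/4"
      and 3: "\<bar>q (D \<union> T) x - nrm (D \<union> T) x\<bar> \<le> d/4 + t/4"
      and 4: "2 * \<bar>cross B T x\<bar> \<le> b/4 + t/4"
      using 2 3 4 nDT by (simp_all add: b_def d_def t_def distrib_left add_divide_distrib)
    have "\<bar>q (A \<union> T) x - q A x - nrm T x\<bar> \<le> b + d + t"
    proof -
      \<comment> \<open>The cross term of \<open>D\<close> and \<open>T\<close> is not estimated
        separately: it is contained in the deviation of \<open>D \<union> T\<close>.\<close>
      have "q (A \<union> T) x - q A x - nrm T x =
          2 * cross B T x + (q (D \<union> T) x - nrm (D \<union> T) x) - (q D x - nrm D x)"
        using qAT qDT nDT by simp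
      then show ?thesis using 2 3 4 pos by linarith
    qed
    then show "\<bar>q (A \<union> T) x - q A x - nrm T x\<bar> \<le> \<eta> * nrm (A \<union> T) x"
      by (simp add: nAT nA b_def d_def t_def distrib_left)
  qed
qed

text \<open>Coordinates below \<open>N\<close> are controlled one by one through
  \<open>coordinates\<close>, the others through \<open>tails\<close>;
  \<open>q_scaled_nonneg\<close> absorbs the cross term.\<close>

lemma uniform_bounds:
  "\<exists>c C. 0 < c \<and> c \<le> 1 \<and> 0 < C \<and> (\<forall>A x. finite A \<longrightarrow> c * nrm A x \<le> q A x \<and> q A x \<le> C * nrm A x)"
proof -
  obtain N where N: "\<And>A x. finite A \<Longrightarrow> A \<subseteq> {N..} \<Longrightarrow> \<bar>q A x - nrm A x\<bar> \<le> 1/2 * nrm A x"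
    using tails[of "1/2"] by auto
  obtain D where D: "\<And>i A x. finite A \<Longrightarrow> i \<in> A \<Longrightarrow> (norm (x i))\<^sup>2 \<le> D i * q A x"
    using coordinates by metis
  define K where "K = (\<Sum>i<N. \<Sum>j<N. norm (g i j))"
  define E where "E = (\<Sum>i<N. max 0 (D i))"
  have K: "0 \<le> K" by (simp add: K_def sum_nonneg)
  have E: "0 \<le> E" by (simp add: E_def sum_nonneg)
  \<comment> \<open>\<open>V\<close> collects \<open>nrm Y x \<le> E * q A x\<close> and
    \<open>nrm T x \<le> 4 * q A x + 4 * q Y x\<close>, where
    \<open>q Y x \<le> K * E * q A x\<close>.\<close>
  define V where "V = E + 4 + 4 * K * E"
  have KE: "0 \<le> K * E" using K E by simp
  then have V: "4 \<le> V" using E by (simp add: V_def)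
  have "1 / V * nrm A x \<le> q A x \<and> q A x \<le> (2 * K + 4) * nrm A x" if A: "finite A" for A x
  proof -
    define Y where "Y = A \<inter> {..<N}"
    define T where "T = A \<inter> {N..}"
    have YT: "A = Y \<union> T" "Y \<inter> T = {}" "finite Y" "finite T" using A by (auto simp: Y_def T_def)
    have nA: "nrm A x = nrm Y x + nrm T x" using YT nrm_Un by simp
    have qA: "q A x = q Y x + q T x + 2 * cross Y T x" using YT q_Un by simp
    \<comment> \<open>The value 2 gives \<open>q T x \<le> 2 * q A x + 2 * q Y x\<close>; the value
      -1 in \<open>s1\<close> bounds the cross term from above.\<close>
    have s2: "0 \<le> 4 * q Y x + q T x + 4 * cross Y T x"
      using q_scaled_nonneg[OF YT(3,4,2), of 2 x] by simp
    have s1: "0 \<le> q Y x + q T x - 2 * cross Y T x"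
      using q_scaled_nonneg[OF YT(3,4,2), of "-1" x] by simp
    have T: "\<bar>q T x - nrm T x\<bar> \<le> 1/2 * nrm T x" using YT by (intro N) (auto simp: T_def)
    have le: "norm (x i) * norm (x j) \<le> nrm Y x" if "i \<in> Y" "j \<in> Y" for i j
    proof -
      have i: "(norm (x i))\<^sup>2 \<le> nrm Y x" and j: "(norm (x j))\<^sup>2 \<le> nrm Y x"
        unfolding nrm_def using that YT by (auto intro: member_le_sum)
      have "2 * (norm (x i) * norm (x j)) \<le> (norm (x i))\<^sup>2 + (norm (x j))\<^sup>2"
        using sum_squares_bound[of "norm (x i)" "norm (x j)"] by (simp add: mult_ac)
      then show ?thesis using i j by linarith
    qed
    have "q Y x \<le> (\<Sum>i\<in>Y. \<Sum>j\<in>Y. norm (x i * cnj (x j) * g i j))"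
      unfolding q_def herm_form_def
      by (intro order_trans[OF complex_Re_le_cmod] sum_norm_le) auto
    also have "\<dots> \<le> (\<Sum>i\<in>Y. \<Sum>j\<in>Y. nrm Y x * norm (g i j))"
      using le by (intro sum_mono) (simp add: norm_mult mult_right_mono)
    also have "\<dots> = nrm Y x * (\<Sum>i\<in>Y. \<Sum>j\<in>Y. norm (g i j))"
      by (simp add: sum_distrib_left)
    also have "\<dots> \<le> nrm Y x * K"
    proof (intro mult_left_mono nrm_nonneg)
      have "(\<Sum>i\<in>Y. \<Sum>j\<in>Y. norm (g i j)) \<le> (\<Sum>i\<in>Y. \<Sum>j<N. norm (g i j))"
        by (intro sum_mono sum_mono2) (auto simp: Y_def)
      also have "\<dots> \<le> K"
        unfolding K_def by (intro sum_mono2) (auto simp: Y_def sum_nonneg)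
      finally show "(\<Sum>i\<in>Y. \<Sum>j\<in>Y. norm (g i j)) \<le> K" .
    qed
    finally have qY: "q Y x \<le> K * nrm Y x" by (simp add: mult.commute)
    have "nrm Y x \<le> (\<Sum>i\<in>Y. max 0 (D i) * q A x)"
      unfolding nrm_def
    proof (intro sum_mono)
      fix i assume "i \<in> Y"
      then have "(norm (x i))\<^sup>2 \<le> D i * q A x" using A D by (simp add: Y_def)
      also have "\<dots> \<le> max 0 (D i) * q A x" using q_nonneg[OF A] by (intro mult_right_mono) auto
      finally show "(norm (x i))\<^sup>2 \<le> max 0 (D i) * q A x" .
    qed
    also have "\<dots> \<le> E * q A x"
      unfolding E_def sum_distrib_right using q_nonneg[OF A]
      by (intro sum_mono2) (auto simp: Y_def)
    finally have nY: "nrm Y x \<le> E * q A x" .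
    have "K * nrm Y x \<le> K * (E * q A x)" using nY K by (rule mult_left_mono)
    then have qY': "q Y x \<le> K * E * q A x" using qY by simp
    have "nrm A x \<le> E * q A x + 4 * q A x + 4 * (K * E * q A x)"
      using nA nY qY' T qA s2 by linarith
    then have "nrm A x \<le> V * q A x" by (simp add: V_def algebra_simps)
    moreover have "q A x \<le> 2 * (K * nrm Y x) + 4 * nrm T x"
      using qA s1 qY T nrm_nonneg[of T x] by linarith
    then have "q A x \<le> (2 * K + 4) * nrm A x"
      using nrm_nonneg[of Y x] mult_nonneg_nonneg[OF K nrm_nonneg[of T x]]
      unfolding nA distrib_left distrib_right mult.assoc by linarith
    ultimately show ?thesis using V by (simp add: field_simps)
  qed
  then show ?thesis using V K
    by (intro exI[of _ "1 / V"] exI[of _ "2 * K + 4"]) auto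
qed

text \<open>Block ends are chosen so that attaching block \<open>k\<close> disturbs the form by at
  most \<open>c / 2^(k+2)\<close> relative to \<open>nrm\<close>. Measuring the error by the lower
  bound \<open>c\<close> keeps every \<open>\<sigma> j\<close> at least
  \<open>c / 2\<close>.\<close>

theorem diagonal_bounds:
  "\<exists>\<sigma> \<tau>. (\<forall>j. 0 < \<sigma> j) \<and> (\<forall>j. 0 < \<tau> j) \<and> \<sigma> \<longlonglongrightarrow> 1 \<and> \<tau> \<longlonglongrightarrow> 1 \<and>
    (\<forall>A x. finite A \<longrightarrow> (\<Sum>j\<in>A. \<sigma> j * (norm (x j))\<^sup>2) \<le> q A x \<and> q A x \<le> (\<Sum>j\<in>A. \<tau> j * (norm (x j))\<^sup>2))"
proof -
  obtain c C where c: "0 < c" "c \<le> 1" "0 < C"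
    and cC: "\<And>A x. finite A \<Longrightarrow> c * nrm A x \<le> q A x" "\<And>A x. finite A \<Longrightarrow> q A x \<le> C * nrm A x"
    using uniform_bounds by metis
  have "\<forall>k. \<exists>N0. \<forall>N\<ge>N0. \<forall>A T x. A \<subseteq> {..<N} \<longrightarrow> finite T \<longrightarrow> T \<subseteq> {N..} \<longrightarrow>
    \<bar>q (A \<union> T) x - q A x - nrm T x\<bar> \<le> c * (1/2)^(k+2) * nrm (A \<union> T) x"
    using c by (intro allI eventually_splits) simp
  then obtain P where P: "\<And>k N A T x. P k \<le> N \<Longrightarrow> A \<subseteq> {..<N} \<Longrightarrow> finite T \<Longrightarrow> T \<subseteq> {N..} \<Longrightarrow>
    \<bar>q (A \<union> T) x - q A x - nrm T x\<bar> \<le> c * (1/2)^(k+2) * nrm (A \<union> T) x"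
    by metis
  \<comment> \<open>Partial sums are strictly increasing and dominate each
    \<open>P k\<close>.\<close>
  define N where "N k = (\<Sum>i\<le>k. Suc (P i))" for k
  have N: "strict_mono N" by (simp add: strict_mono_Suc_iff N_def)
  have PN: "P k \<le> N k" for k by (cases k) (auto simp: N_def)
  define L where "L j = (LEAST i. j < N (Suc i))" for j
  have L: "filterlim L at_top sequentially"
    unfolding filterlim_at_top
  proof
    fix k
    show "\<forall>\<^sub>F j in sequentially. k \<le> L j"
      unfolding eventually_sequentially
    proof (intro exI[of _ "N k"] allI impI)
      fix j assume "N k \<le> j"
      have "j < N (Suc j)" using strict_mono_imp_increasing[OF N, of "Suc j"] by simp
      then have "j < N (Suc (L j))" unfolding L_def by (rule LeastI)
      then have "N k < N (Suc (L j))" using \<open>N k \<le> j\<close> by simp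
      then show "k \<le> L j" using N by (simp add: strict_mono_less)
    qed
  qed
  have small: "(\<lambda>j. c * (1/2)^(Suc (L j))) \<longlonglongrightarrow> 0"
  proof -
    have "(\<lambda>k. c * (1/2)^(Suc k)) \<longlonglongrightarrow> c * 0"
      by (intro tendsto_mult tendsto_const LIMSEQ_Suc LIMSEQ_power_zero) auto
    then have "(\<lambda>k. c * (1/2)^(Suc k)) \<longlonglongrightarrow> 0" by simp
    from filterlim_compose[OF this L] show ?thesis .
  qed
  have half: "c * (1/2)^(Suc (L j)) \<le> c / 2" for j
    using c power_le_one[of "1/2::real" "L j"] by simp
  have ev: "\<forall>\<^sub>F j in sequentially. \<not> j < N 0"
    unfolding eventually_sequentially by (intro exI[of _ "N 0"]) auto
  define \<sigma> where "\<sigma> j = (if j < N 0 then c else 1) - c * (1/2)^(Suc (L j))" for j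
  define \<tau> where "\<tau> j = (if j < N 0 then C else 1) + c * (1/2)^(Suc (L j))" for j
  show ?thesis
  proof (rule exI[of _ \<sigma>], rule exI[of _ \<tau>], intro conjI allI impI)
    show "0 < \<sigma> j" for j using half[of j] c unfolding \<sigma>_def by (split if_split) linarith
    show "0 < \<tau> j" for j using c by (simp add: \<tau>_def add_pos_pos)
    have "(\<lambda>j. 1 - c * (1/2)^(Suc (L j))) \<longlonglongrightarrow> 1 - 0" by (intro tendsto_intros small)
    moreover have "\<forall>\<^sub>F j in sequentially. 1 - c * (1/2)^(Suc (L j)) = \<sigma> j"
      using ev by eventually_elim (simp add: \<sigma>_def)
    ultimately show "\<sigma> \<longlonglongrightarrow> 1" by (simp add: tendsto_cong)
    have "(\<lambda>j. 1 + c * (1/2)^(Suc (L j))) \<longlonglongrightarrow> 1 + 0" by (intro tendsto_intros small)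
    moreover have "\<forall>\<^sub>F j in sequentially. 1 + c * (1/2)^(Suc (L j)) = \<tau> j"
      using ev by eventually_elim (simp add: \<tau>_def)
    ultimately show "\<tau> \<longlonglongrightarrow> 1" by (simp add: tendsto_cong)
    fix A :: "nat set" and x :: "nat \<Rightarrow> complex" assume A: "finite A"
    let ?w = "\<lambda>j. (norm (x j))\<^sup>2"
    have split: "\<bar>q (A \<union> T) x - q A x - sum ?w T\<bar> \<le> c * (1/2)^(k+2) * sum ?w (A \<union> T)"
      if "A \<subseteq> {..<N k}" "T \<subseteq> {N k..<N (Suc k)}" for k A T
    proof -
      have "finite T" "T \<subseteq> {N k..}" using that(2) finite_subset by auto
      from P[OF PN that(1) this, of x] show ?thesis by (simp add: nrm_def)
    qed
    have fin: "finite A" if "A \<subseteq> {..<N 0}" for A using that finite_subset by blast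
    have "(\<Sum>j\<in>A. ((if j < N 0 then c else 1) - c * (1/2)^(Suc (LEAST i. j < N (Suc i)))) * ?w j) \<le> q A x"
    proof (rule block_recursion_lower_bound[where q = "\<lambda>A. q A x", OF N])
      show "c * sum ?w A \<le> q A x" if "A \<subseteq> {..<N 0}" for A
        using cC(1)[OF fin[OF that]] by (simp add: nrm_def)
      show "q A x + 1 * sum ?w T - c * (1/2)^(k+2) * sum ?w (A \<union> T) \<le> q (A \<union> T) x"
        if "A \<subseteq> {..<N k}" "T \<subseteq> {N k..<N (Suc k)}" for k A T
        using split[OF that] by linarith
    qed (use c A in auto)
    then show "(\<Sum>j\<in>A. \<sigma> j * ?w j) \<le> q A x" by (simp only: \<sigma>_def L_def)
    \<comment> \<open>The upper bound is the same recursion for \<open>- q\<close>, with initial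
      weight \<open>- C\<close> and block weight \<open>- 1\<close>.\<close>
    have "(\<Sum>j\<in>A. ((if j < N 0 then - C else - 1) - c * (1/2)^(Suc (LEAST i. j < N (Suc i)))) * ?w j) \<le> - q A x"
    proof (rule block_recursion_lower_bound[where q = "\<lambda>A. - q A x", OF N])
      show "- C * sum ?w A \<le> - q A x" if "A \<subseteq> {..<N 0}" for A
        using cC(2)[OF fin[OF that]] by (simp add: nrm_def)
      show "- q A x + (- 1) * sum ?w T - c * (1/2)^(k+2) * sum ?w (A \<union> T) \<le> - q (A \<union> T) x"
        if "A \<subseteq> {..<N k}" "T \<subseteq> {N k..<N (Suc k)}" for k A T
        using split[OF that] by linarith
    qed (use c A in auto)
    also have "(\<Sum>j\<in>A. ((if j < N 0 then - C else - 1) - c * (1/2)^(Suc (LEAST i. j < N (Suc i)))) * ?w j)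
        = - (\<Sum>j\<in>A. \<tau> j * ?w j)"
      unfolding sum_negf[symmetric] by (intro sum.cong refl) (simp add: \<tau>_def L_def algebra_simps)
    finally show "q A x \<le> (\<Sum>j\<in>A. \<tau> j * ?w j)" by simp
  qed
qed

end

section \<open>Interpolation by bounded analytic functions\<close>

lemma HinfI:
  assumes "f holomorphic_on ball 0 1" "\<And>w. norm w < 1 \<Longrightarrow> norm (f w) \<le> C"
  shows "f \<in> Hinf" "Hinf_norm f \<le> C"
proof -
  show "f \<in> Hinf" using assms by (auto simp: Hinf_def bounded_iff intro!: exI[of _ C])
  show "Hinf_norm f \<le> C" unfolding Hinf_norm_def using assms(2) by (intro cSUP_least) auto
qed

lemma norm_le_Hinf_norm:
  assumes "f \<in> Hinf" "norm w < 1"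
  shows "norm (f w) \<le> Hinf_norm f"
  unfolding Hinf_norm_def
proof (rule cSUP_upper)
  obtain C where "\<forall>v\<in>ball 0 1. norm (f v) \<le> C"
    using assms(1) by (auto simp: Hinf_def bounded_iff)
  then show "bdd_above ((\<lambda>v. norm (f v)) ` ball 0 1)" by (auto intro!: bdd_aboveI[of _ C])
qed (use assms in simp)

lemma norm_le_linf_tail_norm:
  assumes "a \<in> linf" "N \<le> j"
  shows "norm (a j) \<le> linf_tail_norm N a"
  unfolding linf_tail_norm_def
proof (rule cSUP_upper)
  obtain C where "\<forall>i. norm (a i) \<le> C"
    using assms(1) by (auto simp: linf_def bounded_iff)
  then show "bdd_above ((\<lambda>j. norm (a j)) ` {N..})" by (auto intro!: bdd_aboveI[of _ C])
qed (use assms in simp)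

lemma Hinf_holomorphic: "f \<in> Hinf \<Longrightarrow> f holomorphic_on ball 0 1"
  by (simp add: Hinf_def)

lemma Hinf_add_scaled:
  assumes "F \<in> Hinf" "B \<in> Hinf"
  shows "(\<lambda>w. F w + c * B w) \<in> Hinf" "Hinf_norm (\<lambda>w. F w + c * B w) \<le> Hinf_norm F + norm c * Hinf_norm B"
proof -
  have hol: "(\<lambda>w. F w + c * B w) holomorphic_on ball 0 1"
    by (intro holomorphic_intros Hinf_holomorphic assms)
  have "norm (F w + c * B w) \<le> Hinf_norm F + norm c * Hinf_norm B" if "norm w < 1" for w
    using norm_triangle_ineq[of "F w" "c * B w"] norm_le_Hinf_norm[OF assms(1) that]
      mult_left_mono[OF norm_le_Hinf_norm[OF assms(2) that] norm_ge_zero[of c]]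
    by (simp add: norm_mult)
  from HinfI[OF hol this] show "(\<lambda>w. F w + c * B w) \<in> Hinf"
    "Hinf_norm (\<lambda>w. F w + c * B w) \<le> Hinf_norm F + norm c * Hinf_norm B" by blast+
qed

text \<open>The norm of \<open>F + t * B\<close> is Lipschitz in the real parameter
  \<open>t\<close>, at most 1 at 0 and at least 1 at \<open>T\<close>, so the intermediate value
  theorem applies.\<close>

lemma ex_Hinf_norm_eq_1:
  assumes F: "F \<in> Hinf" "Hinf_norm F \<le> 1" and B: "B \<in> Hinf" and v: "norm v < 1" "B v \<noteq> 0"
  shows "\<exists>c. Hinf_norm (\<lambda>w. F w + c * B w) = 1"
proof -
  define h where "h t = Hinf_norm (\<lambda>w. F w + of_real t * B w)" for t :: real
  have le: "h t \<le> h s + Hinf_norm B * \<bar>t - s\<bar>" for s t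
  proof -
    have "(\<lambda>w. F w + of_real t * B w) = (\<lambda>w. (F w + of_real s * B w) + of_real (t - s) * B w)"
      by (simp add: algebra_simps)
    then have "h t \<le> h s + norm (complex_of_real (t - s)) * Hinf_norm B"
      using Hinf_add_scaled(2)[OF Hinf_add_scaled(1)[OF F(1) B, of "of_real s"] B, of "of_real (t - s)"]
      unfolding h_def by (simp only:)
    then show ?thesis by (simp only: norm_of_real mult.commute)
  qed
  have "Hinf_norm B \<ge> 0" using norm_le_Hinf_norm[OF B v(1)] norm_ge_zero order_trans by blast
  then have "(Hinf_norm B)-lipschitz_on UNIV h"
  proof (intro lipschitz_onI)
    show "dist (h t) (h s) \<le> Hinf_norm B * dist t s" for s t
      using le[of t s] le[of s t] by (simp add: dist_real_def abs_minus_commute abs_le_iff)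
  qed
  then have cont: "continuous_on UNIV h" by (rule lipschitz_on_continuous_on)
  \<comment> \<open>At \<open>v\<close> the added term has modulus 2, while \<open>F v\<close> has
    modulus at most 1.\<close>
  define T where "T = 2 / norm (B v)"
  have T: "0 \<le> T" by (simp add: T_def)
  have "2 = norm (of_real T * B v)" using v by (simp add: T_def norm_mult norm_divide)
  also have "\<dots> \<le> norm (F v + of_real T * B v) + norm (F v)"
    using norm_triangle_ineq4[of "F v + of_real T * B v" "F v"] by simp
  also have "\<dots> \<le> h T + 1"
    unfolding h_def using norm_le_Hinf_norm[OF F(1) v(1)] F(2)
    by (intro add_mono norm_le_Hinf_norm Hinf_add_scaled F B v) auto
  finally have "1 \<le> h T" by simp
  moreover have "h 0 \<le> 1" using F by (simp add: h_def)
  ultimately have "\<exists>t\<ge>0. t \<le> T \<and> h t = 1"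
    using T cont by (intro IVT') (auto intro: continuous_on_subset)
  then show ?thesis unfolding h_def by blast
qed

text \<open>A function equal to 1 at \<open>z 0\<close> and 0 at the later nodes is multiplied by
  \<open>w - z 0\<close>; the product is nonzero at nearby points other than
  \<open>z 0\<close>.\<close>

lemma interpolating_ex_vanishing:
  assumes z: "range z \<subseteq> ball 0 1" and "interpolating_Hinf z"
  obtains B v where "B \<in> Hinf" "\<And>j. B (z j) = 0" "norm v < 1" "B v \<noteq> 0"
proof -
  define a :: "nat \<Rightarrow> complex" where "a j = (if j = 0 then 1 else 0)" for j
  have "a \<in> linf" by (auto simp: linf_def bounded_iff a_def intro!: exI[of _ 1])
  then obtain f where f: "f \<in> Hinf" "\<And>j. f (z j) = a j"
    using assms(2) unfolding interpolating_Hinf_def by metis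
  define B where "B w = (w - z 0) * f w" for w
  have z1: "norm (z j) < 1" for j using z by (auto simp: image_subset_iff)
  have "B holomorphic_on ball 0 1"
    unfolding B_def[abs_def] by (intro holomorphic_intros Hinf_holomorphic f)
  moreover have "norm (B w) \<le> 2 * Hinf_norm f" if w: "norm w < 1" for w
    unfolding B_def norm_mult
    using norm_triangle_ineq4[of w "z 0"] z1[of 0] w norm_le_Hinf_norm[OF f(1) w]
    by (intro mult_mono) auto
  ultimately have BH: "B \<in> Hinf" by (rule HinfI)
  have "isCont f (z 0)"
    using holomorphic_on_imp_continuous_on[OF Hinf_holomorphic[OF f(1)]] z1[of 0]
    by (simp add: continuous_on_eq_continuous_at)
  then have "\<forall>\<^sub>F w in at (z 0). f w \<noteq> 0"
    using f(2)[of 0] a_def[of 0] by (intro tendsto_imp_eventually_ne[of f "f (z 0)"]) (auto simp: isCont_def)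
  moreover have "\<forall>\<^sub>F w in at (z 0). w \<in> ball 0 1"
    using z1[of 0] by (intro eventually_at_in_open') auto
  moreover have "\<forall>\<^sub>F w in at (z 0). w \<noteq> z 0" by (simp add: eventually_at_filter)
  ultimately have "\<forall>\<^sub>F w in at (z 0). norm w < 1 \<and> B w \<noteq> 0"
    by eventually_elim (simp add: B_def)
  then obtain v where "norm v < 1" "B v \<noteq> 0"
    using eventually_happens' at_neq_bot by blast
  moreover have "B (z j) = 0" for j by (simp add: B_def f(2) a_def)
  ultimately show ?thesis using BH that by blast
qed

text \<open>By Montel a subsequence of the finite solutions converges. Each single condition holds
  from some index on and passes to the limit, where the strict bound becomes a weak one.\<close>

lemma interpolation_of_finite_interpolation:
  fixes z a :: "nat \<Rightarrow> complex"
  assumes z: "\<And>j. norm (z j) < 1"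
    and ex: "\<And>n. \<exists>F. F holomorphic_on ball 0 1 \<and> (\<forall>w. norm w < 1 \<longrightarrow> norm (F w) < 1) \<and> (\<forall>i<n. F (z i) = a i)"
  shows "\<exists>F\<in>Hinf. Hinf_norm F \<le> 1 \<and> (\<forall>j. F (z j) = a j)"
proof -
  obtain F where F: "\<And>n. F n holomorphic_on ball 0 1" "\<And>n w. norm w < 1 \<Longrightarrow> norm (F n w) < 1"
    "\<And>n i. i < n \<Longrightarrow> F n (z i) = a i" using ex by metis
  define \<H> where "\<H> = {h. h holomorphic_on ball 0 1 \<and> (\<forall>w. norm w < 1 \<longrightarrow> norm (h w) \<le> 1)}"
  have 1: "h holomorphic_on ball 0 1" if "h \<in> \<H>" for h using that by (simp add: \<H>_def)
  have 2: "\<exists>B. \<forall>h\<in>\<H>. \<forall>w\<in>K. norm (h w) \<le> B" if "compact K" "K \<subseteq> ball 0 1" for K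
    using that by (intro exI[of _ 1]) (auto simp: \<H>_def)
  have 3: "range F \<subseteq> \<H>" using F by (auto simp: \<H>_def less_imp_le)
  have "\<exists>G r. G holomorphic_on ball 0 1 \<and> strict_mono (r :: nat \<Rightarrow> nat) \<and>
      (\<forall>w\<in>ball 0 1. (\<lambda>n. F (r n) w) \<longlonglongrightarrow> G w)"
  proof (rule Montel[OF open_ball 1 2 3])
    fix G and r :: "nat \<Rightarrow> nat"
    assume "G holomorphic_on ball 0 1" "strict_mono r"
      "\<And>w. w \<in> ball 0 1 \<Longrightarrow> (\<lambda>n. F (r n) w) \<longlonglongrightarrow> G w"
    then show ?thesis by blast
  qed
  then obtain G r where G: "G holomorphic_on ball 0 1" and r: "strict_mono (r :: nat \<Rightarrow> nat)"
    and lim: "\<And>w. w \<in> ball 0 1 \<Longrightarrow> (\<lambda>n. F (r n) w) \<longlonglongrightarrow> G w"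
    by blast
  have "norm (G w) \<le> 1" if "norm w < 1" for w
  proof (rule tendsto_upperbound)
    show "(\<lambda>n. norm (F (r n) w)) \<longlonglongrightarrow> norm (G w)" using lim that by (intro tendsto_norm) simp
    show "\<forall>\<^sub>F n in sequentially. norm (F (r n) w) \<le> 1"
      using F(2)[OF that] by (simp add: less_imp_le)
  qed simp
  note GH = HinfI[OF G this]
  have "G (z j) = a j" for j
  proof (rule LIMSEQ_unique)
    show "(\<lambda>n. F (r n) (z j)) \<longlonglongrightarrow> G (z j)" using lim z by simp
    have "\<forall>\<^sub>F n in sequentially. F (r n) (z j) = a j"
      unfolding eventually_sequentially
    proof (intro exI[of _ "Suc j"] allI impI)
      fix n assume "Suc j \<le> n"
      then have "j < r n" using strict_mono_imp_increasing[OF r, of n] by linarith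
      then show "F (r n) (z j) = a j" by (rule F(3))
    qed
    then show "(\<lambda>n. F (r n) (z j)) \<longlonglongrightarrow> a j" by (rule tendsto_eventually)
  qed
  then show ?thesis using GH by blast
qed

section \<open>Szego kernels and their asymptotic orthonormality\<close>

definition szego_gram :: "(nat \<Rightarrow> complex) \<Rightarrow> nat \<Rightarrow> nat \<Rightarrow> complex" where
  "szego_gram z i j = of_real (sqrt (1 - (norm (z i))\<^sup>2)) * of_real (sqrt (1 - (norm (z j))\<^sup>2)) * pick z (\<lambda>_. 0) i j"

lemma herm_form_szego_gram:
  "herm_form (szego_gram z) A x = herm_form (pick z (\<lambda>_. 0)) A (\<lambda>i. of_real (sqrt (1 - (norm (z i))\<^sup>2)) * x i)"
  by (rule herm_form_cong) (simp add: szego_gram_def)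

lemma gram_matrix_szego_gram:
  assumes z: "\<And>j. norm (z j) < 1"
  shows "gram_matrix (szego_gram z)"
proof
  show "szego_gram z j i = cnj (szego_gram z i j)" for i j
    by (simp add: szego_gram_def pick_def mult_ac)
  show "szego_gram z i i = 1" for i
  proof -
    have pos: "0 < 1 - (norm (z i))\<^sup>2" using z[of i] by (simp add: abs_square_less_1)
    have "szego_gram z i i = of_real (sqrt (1 - (norm (z i))\<^sup>2) * sqrt (1 - (norm (z i))\<^sup>2) / (1 - (norm (z i))\<^sup>2))"
      by (simp add: szego_gram_def pick_def del: real_sqrt_mult_self flip: complex_norm_square)
    also have "\<dots> = 1" using pos by simp
    finally show ?thesis .
  qed
  show "0 \<le> Re (herm_form (szego_gram z) A x)" if "finite A" for A x
    unfolding herm_form_szego_gram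
    using pick_nonneg_of_interpolation[of A z "\<lambda>_. 0"] that z by auto
qed

text \<open>The Pick form of \<open>f / M\<close> is nonnegative; \<open>herm_form_pick_diff\<close>
  rewrites this as the bound. Allowing any positive \<open>M\<close> above the norm avoids dividing
  by a norm that may be 0.\<close>

lemma szego_gram_multiplier:
  assumes z: "\<And>j. norm (z j) < 1" and A: "finite A" and f: "f \<in> Hinf" "Hinf_norm f \<le> M" "0 < M"
    and fa: "\<And>i. i \<in> A \<Longrightarrow> f (z i) = a i"
  shows "Re (herm_form (szego_gram z) A (\<lambda>i. a i * x i)) \<le> M\<^sup>2 * Re (herm_form (szego_gram z) A x)"
proof -
  let ?y = "\<lambda>i. of_real (sqrt (1 - (norm (z i))\<^sup>2)) * x i"
  define g where "g w = of_real (1 / M) * f w" for w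
  have "g holomorphic_on ball 0 1"
    unfolding g_def[abs_def] by (intro holomorphic_intros Hinf_holomorphic f)
  moreover have "norm (g w) \<le> 1" if "norm w < 1" for w
    using norm_le_Hinf_norm[OF f(1) that] f by (simp add: g_def norm_divide)
  ultimately have "0 \<le> Re (herm_form (pick z (\<lambda>i. g (z i))) A ?y)"
    using A z by (intro pick_nonneg_of_interpolation)
  also have "\<dots> = Re (herm_form (szego_gram z) A x) -
      1 / M\<^sup>2 * Re (herm_form (pick z (\<lambda>_. 0)) A (\<lambda>i. f (z i) * ?y i))"
    unfolding g_def herm_form_pick_diff herm_form_szego_gram
    by (simp add: power2_eq_square)
  also have "herm_form (pick z (\<lambda>_. 0)) A (\<lambda>i. f (z i) * ?y i) = herm_form (szego_gram z) A (\<lambda>i. a i * x i)"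
    unfolding herm_form_szego_gram by (rule herm_form_cong) (simp add: fa mult_ac)
  finally show ?thesis using f(3) by (simp add: field_simps)
qed

text \<open>Sign sequences have tail norm 1, so their interpolants make the tail forms nearly
  invariant under sign changes. Interpolating an indicator sequence gives the coordinate
  bound.\<close>

lemma asymptotically_orthonormal_szego_gram:
  assumes z: "\<And>j. norm (z j) < 1" and I: "interpolating_Hinf z" and E: "EIS_inf z"
  shows "asymptotically_orthonormal_gram (szego_gram z)"
proof -
  interpret gram_matrix "szego_gram z" using gram_matrix_szego_gram z .
  show ?thesis
  proof
    fix \<epsilon> :: real assume "0 < \<epsilon>"
    \<comment> \<open>The cap at 1 gives \<open>\<delta> * \<delta> \<le> \<delta>\<close>, hence
      \<open>(1 + \<delta>)\<^sup>2 \<le> 1 + 3 * \<delta> \<le> 1 + \<epsilon>\<close>.\<close>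
    define \<delta> where "\<delta> = min 1 (\<epsilon> / 3)"
    have \<delta>: "0 < \<delta>" "(1 + \<delta>)\<^sup>2 \<le> 1 + \<epsilon>"
    proof -
      show "0 < \<delta>" using \<open>0 < \<epsilon>\<close> by (simp add: \<delta>_def)
      then have "\<delta> * \<delta> \<le> \<delta> * 1" by (intro mult_left_mono) (auto simp: \<delta>_def)
      moreover have "3 * \<delta> \<le> \<epsilon>" by (simp add: \<delta>_def)
      ultimately show "(1 + \<delta>)\<^sup>2 \<le> 1 + \<epsilon>" by (simp add: power2_eq_square algebra_simps)
    qed
    obtain N where N: "\<And>a. a \<in> linf \<Longrightarrow> \<exists>f\<in>Hinf. (\<forall>n\<ge>N. f (z n) = a n) \<and> Hinf_norm f \<le> (1 + \<delta>) * linf_tail_norm N a"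
      using E \<delta>(1) unfolding EIS_inf_def by blast
    show "\<exists>N. \<forall>A x. finite A \<longrightarrow> A \<subseteq> {N..} \<longrightarrow> \<bar>q A x - nrm A x\<bar> \<le> \<epsilon> * nrm A x"
    proof (intro exI[of _ N] allI impI)
      fix A x assume A: "finite A" "A \<subseteq> {N..}"
      have "q A (\<lambda>i. of_real (s i) * x i) \<le> (1 + \<delta>)\<^sup>2 * q A x" if s: "\<And>i. s i = 1 \<or> s i = -1" for s :: "nat \<Rightarrow> real" and x
      proof -
        define a where "a i = complex_of_real (s i)" for i
        have na: "norm (a i) = 1" for i using s[of i] by (auto simp: a_def)
        then have "a \<in> linf" by (auto simp: linf_def bounded_iff)
        moreover have "linf_tail_norm N a = 1" by (simp add: linf_tail_norm_def na)
        ultimately obtain f where f: "f \<in> Hinf" "\<And>n. n \<ge> N \<Longrightarrow> f (z n) = a n" "Hinf_norm f \<le> 1 + \<delta>"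
          using N[of a] by auto
        show ?thesis unfolding q_def a_def[symmetric]
          using A \<delta>(1) f by (intro szego_gram_multiplier[OF z A(1) f(1,3)]) auto
      qed
      note bounds = sign_invariance_bounds[OF A(1) zero_le_power2 this]
      have n: "0 \<le> nrm A x" and q: "0 \<le> q A x" using nrm_nonneg q_nonneg A by auto
      have "nrm A x \<le> (1 + \<epsilon>) * q A x" "q A x \<le> (1 + \<epsilon>) * nrm A x"
        using bounds[of x] mult_right_mono[OF \<delta>(2) q] mult_right_mono[OF \<delta>(2) n] by auto
      then have 1: "nrm A x - q A x \<le> \<epsilon> * q A x" and 2: "q A x - nrm A x \<le> \<epsilon> * nrm A x"
        by (simp_all add: algebra_simps)
      have "nrm A x - q A x \<le> \<epsilon> * nrm A x"
      proof (cases "q A x \<le> nrm A x")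
        case True
        then have "\<epsilon> * q A x \<le> \<epsilon> * nrm A x" using \<open>0 < \<epsilon>\<close> by simp
        with 1 show ?thesis by linarith
      next
        case False
        moreover have "0 \<le> \<epsilon> * nrm A x" using \<open>0 < \<epsilon>\<close> n by simp
        ultimately show ?thesis by linarith
      qed
      then show "\<bar>q A x - nrm A x\<bar> \<le> \<epsilon> * nrm A x" using 2 by linarith
    qed
  next
    fix i
    define a :: "nat \<Rightarrow> complex" where "a j = (if j = i then 1 else 0)" for j
    have "a \<in> linf" by (auto simp: linf_def bounded_iff a_def intro!: exI[of _ 1])
    then obtain f where f: "f \<in> Hinf" "\<And>j. f (z j) = a j"
      using I unfolding interpolating_Hinf_def by metis
    define M where "M = \<bar>Hinf_norm f\<bar> + 1"
    show "\<exists>C. \<forall>A x. finite A \<longrightarrow> i \<in> A \<longrightarrow> (norm (x i))\<^sup>2 \<le> C * q A x"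
    proof (intro exI[of _ "M\<^sup>2"] allI impI)
      fix A x assume A: "finite A" "i \<in> A"
      have "herm_form (szego_gram z) A (\<lambda>j. a j * x j) = herm_form (szego_gram z) {i} x"
      proof -
        have "herm_form (szego_gram z) A (\<lambda>j. a j * x j) =
          (\<Sum>l\<in>A. if l = i then \<Sum>j\<in>A. if j = i then x i * cnj (x i) * szego_gram z i i else 0 else 0)"
          unfolding herm_form_def by (intro sum.cong refl) (auto simp: a_def intro!: sum.cong)
        also have "\<dots> = x i * cnj (x i) * szego_gram z i i"
          using A by (simp only: sum.delta' sum.delta if_True)
        finally show ?thesis by (simp add: herm_form_def)
      qed
      then have "(norm (x i))\<^sup>2 = q A (\<lambda>j. a j * x j)"
        using q_singleton[of i x] by (simp add: q_def)
      also have "\<dots> \<le> M\<^sup>2 * q A x"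
        unfolding q_def using f by (intro szego_gram_multiplier[OF z A(1) f(1)]) (auto simp: M_def)
      finally show "(norm (x i))\<^sup>2 \<le> M\<^sup>2 * q A x" .
    qed
  qed
qed

lemma interpolating_Hinf_inj:
  assumes "interpolating_Hinf z"
  shows "inj z"
proof (rule injI, rule ccontr)
  fix i j assume "z i = z j" "i \<noteq> j"
  define a :: "nat \<Rightarrow> complex" where "a k = (if k = i then 1 else 0)" for k
  have "a \<in> linf" by (auto simp: linf_def bounded_iff a_def intro!: exI[of _ 1])
  then obtain f where "\<And>k. f (z k) = a k"
    using assms unfolding interpolating_Hinf_def by metis
  then have "a i = a j" using \<open>z i = z j\<close> by metis
  then show False using \<open>i \<noteq> j\<close> by (simp add: a_def)
qed

section \<open>From diagonal bounds to weights, and back\<close>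

text \<open>The diagonal bounds reduce positivity of every finite Pick form to the scalar inequality
  \<open>\<tau> j * (norm (a j))\<^sup>2 < \<sigma> j\<close>.\<close>

lemma EIS_inf_imp_ex_weights:
  assumes z: "\<And>j. norm (z j) < 1" and I: "interpolating_Hinf z" and E: "EIS_inf z"
  shows "\<exists>m :: nat \<Rightarrow> real. (\<forall>j. m j \<in> {0<..<1}) \<and> m \<longlonglongrightarrow> 1 \<and>
    (\<forall>a. (\<forall>j. norm (a j) \<le> m j) \<longrightarrow> (\<exists>F\<in>Hinf. Hinf_norm F \<le> 1 \<and> (\<forall>j. F (z j) = a j)))"
proof -
  interpret asymptotically_orthonormal_gram "szego_gram z"
    using asymptotically_orthonormal_szego_gram z I E .
  obtain \<sigma> \<tau> :: "nat \<Rightarrow> real" where pos: "\<And>j. 0 < \<sigma> j" "\<And>j. 0 < \<tau> j" and lim: "\<sigma> \<longlonglongrightarrow> 1" "\<tau> \<longlonglongrightarrow> 1"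
    and bnd: "\<And>A x. finite A \<Longrightarrow> (\<Sum>j\<in>A. \<sigma> j * (norm (x j))\<^sup>2) \<le> q A x"
      "\<And>A x. finite A \<Longrightarrow> q A x \<le> (\<Sum>j\<in>A. \<tau> j * (norm (x j))\<^sup>2)"
    using diagonal_bounds by blast
  have st: "\<sigma> j \<le> \<tau> j" for j
    using bnd(1)[of "{j}" "\<lambda>_. 1"] bnd(2)[of "{j}" "\<lambda>_. 1"] by simp
  \<comment> \<open>This factor tends to 1 and makes \<open>m j\<close> strictly smaller than
    \<open>sqrt (\<sigma> j / \<tau> j)\<close>; the double successor keeps \<open>p 0\<close>
    positive.\<close>
  define p where "p j = 1 - inverse (real (Suc (Suc j)))" for j :: nat
  define m where "m j = sqrt (\<sigma> j / \<tau> j) * p j" for j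
  have p: "0 < p j" "p j < 1" for j by (simp_all add: p_def field_simps)
  have s01: "0 < sqrt (\<sigma> j / \<tau> j)" "sqrt (\<sigma> j / \<tau> j) \<le> 1" for j
    using pos st by simp_all
  have m0: "0 < m j" for j using p s01 by (simp add: m_def)
  have m_less: "m j < sqrt (\<sigma> j / \<tau> j)" for j
    unfolding m_def using p[of j] s01[of j] by simp
  have "(\<lambda>j. 1 - inverse (real (Suc (Suc j)))) \<longlonglongrightarrow> 1 - 0"
    by (intro tendsto_diff tendsto_const LIMSEQ_Suc[OF LIMSEQ_inverse_real_of_nat])
  then have p1: "p \<longlonglongrightarrow> 1" by (simp add: p_def[abs_def])
  have "(\<lambda>j. sqrt (\<sigma> j / \<tau> j) * p j) \<longlonglongrightarrow> sqrt (1 / 1) * 1"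
    by (intro tendsto_intros lim p1) simp
  then have m1: "m \<longlonglongrightarrow> 1" by (simp add: m_def[abs_def])
  have ex: "\<exists>F\<in>Hinf. Hinf_norm F \<le> 1 \<and> (\<forall>j. F (z j) = a j)" if a: "\<And>j. norm (a j) \<le> m j" for a
  proof (rule interpolation_of_finite_interpolation[OF z])
    fix n
    have "\<exists>F. F holomorphic_on ball 0 1 \<and> (\<forall>w. norm w < 1 \<longrightarrow> norm (F w) < 1) \<and> (\<forall>i\<in>{..<n}. F (z i) = a i)"
    proof (rule interpolation_of_pick_positive)
      show "inj_on z {..<n}" using interpolating_Hinf_inj[OF I] inj_on_subset by blast
      fix x :: "nat \<Rightarrow> complex" assume x: "\<exists>i\<in>{..<n}. x i \<noteq> 0"
      define r where "r i = sqrt (1 - (norm (z i))\<^sup>2)" for i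
      have r: "0 < r i" for i using z[of i] by (simp add: r_def abs_square_less_1)
      \<comment> \<open>Undoing the kernel normalisation turns the Pick form at \<open>x\<close>
        into Gram forms at \<open>y\<close>.\<close>
      define y where "y i = x i / of_real (r i)" for i
      have xy: "of_real (r i) * y i = x i" for i using r[of i] by (simp add: y_def)
      have "herm_form (pick z a) {..<n} x = herm_form (pick z (\<lambda>_. 0)) {..<n} x
          - herm_form (pick z (\<lambda>_. 0)) {..<n} (\<lambda>i. a i * x i)"
        using herm_form_pick_diff[of z 1 a] by simp
      also have "herm_form (pick z (\<lambda>_. 0)) {..<n} x = herm_form (szego_gram z) {..<n} y"
        unfolding herm_form_szego_gram r_def[symmetric] xy ..
      also have "herm_form (pick z (\<lambda>_. 0)) {..<n} (\<lambda>i. a i * x i) = herm_form (szego_gram z) {..<n} (\<lambda>i. a i * y i)"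
        unfolding herm_form_szego_gram r_def[symmetric] xy[symmetric] by (simp only: mult.left_commute)
      finally have "Re (herm_form (pick z a) {..<n} x) = q {..<n} y - q {..<n} (\<lambda>i. a i * y i)"
        by (simp add: q_def)
      also have "\<dots> \<ge> (\<Sum>j<n. \<sigma> j * (norm (y j))\<^sup>2) - (\<Sum>j<n. \<tau> j * (norm (a j * y j))\<^sup>2)"
        by (intro diff_mono bnd) auto
      also have "(\<Sum>j<n. \<sigma> j * (norm (y j))\<^sup>2) - (\<Sum>j<n. \<tau> j * (norm (a j * y j))\<^sup>2)
          = (\<Sum>j<n. (\<sigma> j - \<tau> j * (norm (a j))\<^sup>2) * (norm (y j))\<^sup>2)"
        by (simp add: norm_mult power_mult_distrib left_diff_distrib sum_subtractf mult.assoc)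
      finally have ge: "(\<Sum>j<n. (\<sigma> j - \<tau> j * (norm (a j))\<^sup>2) * (norm (y j))\<^sup>2) \<le> Re (herm_form (pick z a) {..<n} x)" .
      have c: "0 < \<sigma> j - \<tau> j * (norm (a j))\<^sup>2" for j
      proof -
        have "(norm (a j))\<^sup>2 < (sqrt (\<sigma> j / \<tau> j))\<^sup>2"
          using a[of j] m_less[of j] by (intro power_strict_mono) auto
        also have "\<dots> = \<sigma> j / \<tau> j" using pos[of j] by simp
        finally show ?thesis using pos[of j] by (simp add: field_simps)
      qed
      obtain i where i: "i < n" "x i \<noteq> 0" using x by auto
      have "0 < (\<Sum>j<n. (\<sigma> j - \<tau> j * (norm (a j))\<^sup>2) * (norm (y j))\<^sup>2)"
      proof (rule sum_pos2)
        show "i \<in> {..<n}" using i by simp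
        show "0 < (\<sigma> i - \<tau> i * (norm (a i))\<^sup>2) * (norm (y i))\<^sup>2"
          using c[of i] i r[of i] by (simp add: y_def)
        show "0 \<le> (\<sigma> j - \<tau> j * (norm (a j))\<^sup>2) * (norm (y j))\<^sup>2" for j
          by (intro mult_nonneg_nonneg less_imp_le[OF c] zero_le_power2)
      qed simp
      then show "0 < Re (herm_form (pick z a) {..<n} x)" using ge by linarith
    qed (use z in auto)
    then show "\<exists>F. F holomorphic_on ball 0 1 \<and> (\<forall>w. norm w < 1 \<longrightarrow> norm (F w) < 1) \<and> (\<forall>i<n. F (z i) = a i)"
      by auto
  qed
  show ?thesis
  proof (intro exI[of _ m] conjI allI impI)
    show "m j \<in> {0<..<1}" for j
      using m0[of j] less_le_trans[OF m_less[of j] s01(2)[of j]] by simp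
  qed (use m1 ex in auto)
qed

text \<open>From some index on \<open>m j\<close> exceeds \<open>1 / (1 + \<epsilon>)\<close>, so
  \<open>a\<close> divided by \<open>1 + \<epsilon>\<close> times its tail norm is admissible there;
  multiplying back gives the norm bound.\<close>

lemma EIS_inf_of_weights:
  fixes m :: "nat \<Rightarrow> real"
  assumes m: "m \<longlonglongrightarrow> 1" "\<And>j. 0 < m j"
    and ex: "\<And>a. (\<And>j. norm (a j) \<le> m j) \<Longrightarrow> \<exists>F\<in>Hinf. Hinf_norm F \<le> 1 \<and> (\<forall>j. F (z j) = a j)"
  shows "EIS_inf z"
  unfolding EIS_inf_def
proof (intro allI impI)
  fix \<epsilon> :: real assume \<epsilon>: "0 < \<epsilon>"
  then have "1 / (1 + \<epsilon>) < 1" by simp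
  then have "\<forall>\<^sub>F j in sequentially. 1 / (1 + \<epsilon>) < m j"
    using m(1) by (intro order_tendstoD)
  then obtain N where N: "\<And>j. N \<le> j \<Longrightarrow> 1 / (1 + \<epsilon>) < m j"
    by (auto simp: eventually_sequentially)
  show "\<exists>N. \<forall>a\<in>linf. \<exists>f\<in>Hinf. (\<forall>n\<ge>N. f (z n) = a n) \<and> Hinf_norm f \<le> (1 + \<epsilon>) * linf_tail_norm N a"
  proof (intro exI[of _ N] ballI)
    fix a assume a: "a \<in> linf"
    define T where "T = linf_tail_norm N a"
    have aT: "norm (a j) \<le> T" if "N \<le> j" for j
      unfolding T_def using norm_le_linf_tail_norm[OF a that] .
    have T0: "0 \<le> T" using aT[of N] norm_ge_zero order_trans by blast
    define K where "K = (1 + \<epsilon>) * T"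
    have K0: "0 \<le> K" using T0 \<epsilon> by (simp add: K_def)
    \<comment> \<open>Terms before \<open>N\<close> are set to 0, since the tail norm does not
      control them. If \<open>T = 0\<close>, then \<open>K = 0\<close> and division yields 0, which
      is right because the tail of \<open>a\<close> vanishes.\<close>
    define b where "b j = (if N \<le> j then a j / of_real K else 0)" for j
    have "norm (b j) \<le> m j" for j
    proof (cases "N \<le> j \<and> 0 < T")
      case True
      then have "norm (b j) = norm (a j) / K" using K0 by (simp add: b_def norm_divide)
      also have "\<dots> \<le> T / K" using True aT K0 by (intro divide_right_mono) auto
      also have "\<dots> = 1 / (1 + \<epsilon>)" using True by (simp add: K_def)
      finally show ?thesis using N[of j] True by simp
    next
      case False
      then have "b j = 0" using T0 by (auto simp: b_def K_def)
      then show ?thesis using m(2)[of j] by (simp add: less_imp_le)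
    qed
    then obtain F where F: "F \<in> Hinf" "Hinf_norm F \<le> 1" "\<And>j. F (z j) = b j" using ex by metis
    have hol: "(\<lambda>w. of_real K * F w) holomorphic_on ball 0 1"
      by (intro holomorphic_intros Hinf_holomorphic F)
    have "norm (of_real K * F w) \<le> K" if "norm w < 1" for w
      using norm_le_Hinf_norm[OF F(1) that] F(2) K0 mult_left_mono[of "norm (F w)" 1 K]
      by (simp add: norm_mult)
    note f = HinfI[OF hol this]
    have "of_real K * F (z n) = a n" if "N \<le> n" for n
    proof (cases "T = 0")
      case True
      then show ?thesis using aT[OF that] by (simp add: K_def)
    next
      case False
      then have "K \<noteq> 0" using \<epsilon> by (simp add: K_def)
      then show ?thesis using that by (simp add: F(3) b_def)
    qed
    then show "\<exists>f\<in>Hinf. (\<forall>n\<ge>N. f (z n) = a n) \<and> Hinf_norm f \<le> (1 + \<epsilon>) * linf_tail_norm N a"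
      using f unfolding K_def T_def by (intro bexI[of _ "\<lambda>w. of_real K * F w"]) (auto simp: K_def T_def)
  qed
qed

theorem theorem2p9:
  fixes z :: "nat \<Rightarrow> complex"
  assumes "range z \<subseteq> ball 0 1"
    and "interpolating_Hinf z"
  shows "EIS_inf z \<longleftrightarrow>
    (\<exists>m :: nat \<Rightarrow> real. (\<forall>j. m j \<in> {0<..<1}) \<and> m \<longlonglongrightarrow> 1 \<and>
      (\<forall>a :: nat \<Rightarrow> complex. (\<forall>j. norm (a j) \<le> m j) \<longrightarrow>
        (\<exists>F\<in>Hinf. Hinf_norm F = 1 \<and> (\<forall>j. F (z j) = a j))))"
proof
  have z: "norm (z j) < 1" for j using assms(1) by (auto simp: image_subset_iff)
  assume "EIS_inf z"
  then obtain m :: "nat \<Rightarrow> real" where m: "\<forall>j. m j \<in> {0<..<1}" "m \<longlonglongrightarrow> 1"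
    and ex: "\<And>a. (\<And>j. norm (a j) \<le> m j) \<Longrightarrow> \<exists>F\<in>Hinf. Hinf_norm F \<le> 1 \<and> (\<forall>j. F (z j) = a j)"
    using EIS_inf_imp_ex_weights[OF z assms(2)] by blast
  \<comment> \<open>\<open>B\<close> vanishes at all nodes, so adding a multiple of it raises the
    norm to 1 without changing interpolated values.\<close>
  obtain B v where B: "B \<in> Hinf" "\<And>j. B (z j) = 0" "norm v < 1" "B v \<noteq> 0"
    using interpolating_ex_vanishing[OF assms] by blast
  have "\<exists>F\<in>Hinf. Hinf_norm F = 1 \<and> (\<forall>j. F (z j) = a j)" if a: "\<forall>j. norm (a j) \<le> m j" for a
  proof -
    obtain F where F: "F \<in> Hinf" "Hinf_norm F \<le> 1" "\<And>j. F (z j) = a j" using ex[of a] a by blast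
    obtain c where c: "Hinf_norm (\<lambda>w. F w + c * B w) = 1"
      using ex_Hinf_norm_eq_1[OF F(1,2) B(1,3,4)] by blast
    show ?thesis
      using c Hinf_add_scaled(1)[OF F(1) B(1)] F(3) B(2)
      by (intro bexI[of _ "\<lambda>w. F w + c * B w"]) auto
  qed
  then show "\<exists>m :: nat \<Rightarrow> real. (\<forall>j. m j \<in> {0<..<1}) \<and> m \<longlonglongrightarrow> 1 \<and>
      (\<forall>a :: nat \<Rightarrow> complex. (\<forall>j. norm (a j) \<le> m j) \<longrightarrow>
        (\<exists>F\<in>Hinf. Hinf_norm F = 1 \<and> (\<forall>j. F (z j) = a j)))"
    using m by blast
next
  assume "\<exists>m :: nat \<Rightarrow> real. (\<forall>j. m j \<in> {0<..<1}) \<and> m \<longlonglongrightarrow> 1 \<and>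
      (\<forall>a :: nat \<Rightarrow> complex. (\<forall>j. norm (a j) \<le> m j) \<longrightarrow>
        (\<exists>F\<in>Hinf. Hinf_norm F = 1 \<and> (\<forall>j. F (z j) = a j)))"
  then obtain m :: "nat \<Rightarrow> real" where m: "\<And>j. m j \<in> {0<..<1}" "m \<longlonglongrightarrow> 1"
    and ex: "\<And>a. (\<And>j. norm (a j) \<le> m j) \<Longrightarrow> \<exists>F\<in>Hinf. Hinf_norm F = 1 \<and> (\<forall>j. F (z j) = a j)"
    by metis
  show "EIS_inf z"
  proof (rule EIS_inf_of_weights[OF m(2)])
    show "0 < m j" for j using m(1)[of j] by simp
    show "\<exists>F\<in>Hinf. Hinf_norm F \<le> 1 \<and> (\<forall>j. F (z j) = a j)" if "\<And>j. norm (a j) \<le> m j" for a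
      using ex[OF that] by force
  qed
qed

end
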